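(* Let $Y\subseteq\mathbb{R}^2$ be a separated net that is created from a Penrose tiling. Then there exist $\beta>0$ and a bijection $\Phi:Y\to\beta\cdot\mathbb{Z}^2$ with $\sup_{y\in Y}\|\Phi(y)-y\|<\infty$. In particular, $Y$ is biLipschitz to $\mathbb{Z}^2$: there exist a bijection $\Psi:Y\to\mathbb{Z}^2$ and $C\ge1$ with $\frac1C\|y-y'\|\le\|\Psi(y)-\Psi(y')\|\le C\|y-y'\|$ for all $y,y'\in Y$.
   Context: Separated net: a set $Y\subseteq\mathbb{R}^d$ such that for some $R,r>0$ every ball of radius $R$ intersects $Y$ and every ball of radius $r$ contains at most one point of $Y$. $\|\cdot\|$ is any norm on $\mathbb{R}^2$. A separated net $Y$ is created from a tiling $\tau$ of $\mathbb{R}^2$ if there is a bijection $T\mapsto y_T$ from the tiles of $\tau$ onto $Y$ with $y_T\in T$ for every tile $T$. Penrose tiling (by triangles): let $\varphi=\frac{1+\sqrt5}{2}$. There are two basic tiles (up to isometry). (1) The acute isosceles triangle with angles $36^\circ,72^\circ,72^\circ$, base $2$ and legs $2\varphi$; its vertices are marked $(A,B,C)$ with $A$ the $36^\circ$ apex and $B,C$ the base vertices. (2) The obtuse isosceles triangle with angles $36^\circ,36^\circ,108^\circ$, legs $2$ and base $2\varphi$; its vertices are marked $(D,E,F)$ with $F$ the $108^\circ$ apex and $D,E$ the base vertices. The Penrose substitution $H$ has inflation constant $\xi=\varphi$ and dissects the tiles into copies of the basic tiles scaled by $\varphi^{-1}$ as follows. - An acute triangle $(A,B,C)$: let $P$ be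 the point of segment $AC$ with $|AP|=|AC|/\varphi$ and $Q$ the point of segment $AB$ with $|AQ|=|AB|/\varphi^2$. It is dissected into the acute triangles $(B,C,P)$ and $(B,Q,P)$ and the obtuse triangle $(A,P,Q)$ (vertices listed in the marked order, so the first vertex of each acute triangle is its apex and the last vertex of the obtuse triangle is its apex). - An obtuse triangle $(D,E,F)$: let $P$ be the point of segment $DE$ with $|DP|=|DE|/\varphi$. It is dissected into the acute triangle $(D,P,F)$ and the obtuse triangle $(E,F,P)$. Thus an acute triangle yields 2 acute and 1 obtuse triangles, and an obtuse triangle yields 1 acute and 1 obtuse triangle. $H$ is applied to collections of tiles tile by tile, and $\xi H$ is $H$ followed by dilation by $\xi$. The prototiles are the (finitely many, up to translation) isometric copies of the two marked triangles having rotation angles in multiples of $36^\circ$ (relative to a fixed position with one side horizontal). A Penrose tiling is a tiling $\tau$ of $\mathbb{R}^2$ by translates of these prototiles (closed triangles with pairwise disjoint interiors covering the plane) such that every finite sub-collection of tiles of $\tau$ is, up to translation, contained in $(\xi H)^m(S)$ for some prototile $S$ and some $m\in\mathbb{N}$. *)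

theory Defs
  imports "HOL-Analysis.Analysis"
begin

definition is_norm :: "('a::real_vector \<Rightarrow> real) \<Rightarrow> bool" where
  "is_norm N \<longleftrightarrow>
     (\<forall>x. 0 \<le> N x) \<and> (\<forall>x. N x = 0 \<longleftrightarrow> x = 0) \<and>
     (\<forall>c x. N (c *\<^sub>R x) = \<bar>c\<bar> * N x) \<and>
     (\<forall>x y. N (x + y) \<le> N x + N y)"

(* The balls are Euclidean; since all norms on a finite-dimensional space are equivalent,
   any other norm gives the same separated nets (with other constants R, r). *)
definition separated_net :: "'a::euclidean_space set \<Rightarrow> bool" where
  "separated_net Y \<longleftrightarrow>
     (\<exists>R>0. \<exists>r>0.
        (\<forall>x. ball x R \<inter> Y \<noteq> {}) \<and>
        (\<forall>x. \<forall>y \<in> ball x r \<inter> Y. \<forall>y' \<in> ball x r \<inter> Y. y = y'))"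

definition int_lattice :: "(real^2) set" where
  "int_lattice = {x. \<forall>i. x $ i \<in> \<int>}"

definition golden :: real where
  "golden = (1 + sqrt 5) / 2"

(* A tile is a triangle given by its marked vertices: Acute A B C has the 36 degree apex A,
   Obtuse D E F has the 108 degree apex F. The datatype itself puts no constraint on the
   shape; that is done by prototiles below. *)
datatype (vertices: 'a) tile = Acute 'a 'a 'a | Obtuse 'a 'a 'a
  for map: map_tile

definition region :: "(real^2) tile \<Rightarrow> (real^2) set" where
  "region T = convex hull (vertices T)"

definition translate_tile :: "real^2 \<Rightarrow> (real^2) tile \<Rightarrow> (real^2) tile" where
  "translate_tile v = map_tile (\<lambda>x. v + x)"

definition plane_rotation :: "real \<Rightarrow> real^2 \<Rightarrow> real^2" where
  "plane_rotation t x =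
     vector [cos t * x$1 - sin t * x$2, sin t * x$1 + cos t * x$2]"

definition plane_reflection :: "real^2 \<Rightarrow> real^2" where
  "plane_reflection x = vector [x$1, - x$2]"

(* Base BC of length 2 on the x-axis, apex A at distance 2 * golden from B in direction
   72 degrees. *)
definition base_acute :: "(real^2) tile" where
  "base_acute =
     Acute ((2 * golden) *\<^sub>R vector [cos (2 * pi / 5), sin (2 * pi / 5)])
           0
           (vector [2, 0])"

(* Base DE of length 2 * golden on the x-axis, apex F at distance 2 from D in direction
   36 degrees. *)
definition base_obtuse :: "(real^2) tile" where
  "base_obtuse =
     Obtuse 0
            (vector [2 * golden, 0])
            (2 *\<^sub>R vector [cos (pi / 5), sin (pi / 5)])"

(* Both orientations are needed: in the dissection of an acute triangle, the child (B, Q, P)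
   has the orientation opposite to that of (A, B, C). *)
definition prototiles :: "(real^2) tile set" where
  "prototiles =
     {map_tile (plane_rotation (real k * (pi / 5)) \<circ> g) T | k g T.
        k < 10 \<and> g \<in> {id, plane_reflection} \<and> T \<in> {base_acute, base_obtuse}}"

fun dissect :: "(real^2) tile \<Rightarrow> (real^2) tile set" where
  "dissect (Acute A B C) =
     (let P = A + (1 / golden) *\<^sub>R (C - A);
          Q = A + (1 / golden\<^sup>2) *\<^sub>R (B - A)
      in {Acute B C P, Acute B Q P, Obtuse A P Q})"
| "dissect (Obtuse D E F) =
     (let P = D + (1 / golden) *\<^sub>R (E - D)
      in {Acute D P F, Obtuse E F P})"

definition penrose_H :: "(real^2) tile set \<Rightarrow> (real^2) tile set" where
  "penrose_H \<C> = (\<Union>T\<in>\<C>. dissect T)"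

definition inflated_H :: "(real^2) tile set \<Rightarrow> (real^2) tile set" where
  "inflated_H \<C> = map_tile (\<lambda>x. golden *\<^sub>R x) ` penrose_H \<C>"

definition penrose_tiling :: "(real^2) tile set \<Rightarrow> bool" where
  "penrose_tiling \<tau> \<longleftrightarrow>
     (\<forall>T\<in>\<tau>. \<exists>S\<in>prototiles. \<exists>v. T = translate_tile v S) \<and>
     (\<Union>T\<in>\<tau>. region T) = UNIV \<and>
     (\<forall>T\<in>\<tau>. \<forall>T'\<in>\<tau>. T \<noteq> T' \<longrightarrow> interior (region T) \<inter> interior (region T') = {}) \<and>
     (\<forall>\<C>. finite \<C> \<and> \<C> \<subseteq> \<tau> \<longrightarrow>
        (\<exists>S\<in>prototiles. \<exists>m v. translate_tile v ` \<C> \<subseteq> (inflated_H ^^ m) {S}))"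

definition created_from :: "(real^2) set \<Rightarrow> (real^2) tile set \<Rightarrow> bool" where
  "created_from Y \<tau> \<longleftrightarrow>
     (\<exists>y. bij_betw y \<tau> Y \<and> (\<forall>T\<in>\<tau>. y T \<in> region T))"

end

theory Submission imports Defs
begin

text \<open>
  Attach to every point of a square lattice of the right mesh the square cell next to it. A bijection between
  tiles and cells that moves points by a bounded amount exists by Hall's marriage theorem, in the
  version for locally finite infinite graphs (\<open>perfect_matching_infinite\<close>), as soon as every finite
  set of tiles has at least as many cells close to it, and conversely. As cells have
  equal area, this compares the number of tiles in a finite set \<open>F\<close> with their area.

  For a whole supertile the two agree up to an error that decays: the substitution matrix has
  eigenvalues \<open>\<phi>\<^sup>2\<close>, belonging to the area, and \<open>\<phi>\<close> to the power \<open>-2\<close>, so the discrepancy of a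
  supertile of generation \<open>m\<close> is a constant times \<open>\<phi>\<close> to the power \<open>-2 m\<close> (\<open>excess_descendants\<close>).
  A finite set \<open>F\<close> in a supertile is a union of maximal supertiles. The parent of each of them
  meets both \<open>F\<close> and its complement and, by connectedness, contains a tile outside \<open>F\<close> that
  touches \<open>F\<close>. Hence there are at most three maximal supertiles of a generation for each such boundary
  tile, and the discrepancy of \<open>F\<close> is at most a geometric series times the number of its
  neighbours (\<open>excess_mixed_descendants\<close>, \<open>penrose_discrepancy\<close>).

  The constant is smaller than the weight of a single tile in either way of counting. Therefore
  adding its neighbours to \<open>F\<close> outweighs the discrepancy (\<open>penrose_counting\<close>), and Hall's condition
  follows (\<open>penrose_bounded_displacement\<close>). A bijection of bounded displacement between separated
  sets is bilipschitz.
\<close>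

section \<open>Hall's marriage theorem for infinite families\<close>

text \<open>
  Zorn's lemma is applied to the sets of pairs whose deletion keeps Hall's condition. Unions of
  chains stay in this family because Hall's condition at a finite \<open>J\<close> only involves the finitely
  many pairs over \<open>J\<close>, and these are already deleted at some member of the chain.
\<close>
lemma hall_minimal_system:
  fixes S :: "('a \<times> 'b) set"
  assumes fin: "\<And>i. i \<in> I \<Longrightarrow> finite (S `` {i})"
    and hall: "\<And>J. finite J \<Longrightarrow> J \<subseteq> I \<Longrightarrow> card J \<le> card (S `` J)"
  obtains R where "R \<subseteq> S" "\<And>J. finite J \<Longrightarrow> J \<subseteq> I \<Longrightarrow> card J \<le> card (R `` J)"
    "\<And>p. p \<in> R \<Longrightarrow> \<exists>J. finite J \<and> J \<subseteq> I \<and> card ((R - {p}) `` J) < card J"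
proof -
  define H where "H R \<longleftrightarrow> (\<forall>J. finite J \<and> J \<subseteq> I \<longrightarrow> card J \<le> card (R `` J))" for R :: "('a \<times> 'b) set"
  define \<D> where "\<D> = {D. D \<subseteq> S \<and> H (S - D)}"
  have "\<exists>M\<in>\<D>. \<forall>X\<in>\<D>. M \<subseteq> X \<longrightarrow> X = M"
  proof (rule subset_Zorn')
    fix \<C> assume ch: "subset.chain \<D> \<C>"
    then have sub: "\<C> \<subseteq> \<D>" by (simp add: subset.chain_def)
    have "H (S - \<Union>\<C>)"
    proof (cases "\<C> = {}")
      case True
      then show ?thesis using hall by (simp add: H_def)
    next
      case False
      show ?thesis
        unfolding H_def
      proof (intro allI impI, elim conjE)
        fix J assume J: "finite J" "J \<subseteq> I"
        have eq: "S \<inter> (J \<times> UNIV) = (\<Union>i\<in>J. Pair i ` (S `` {i}))" by auto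
        have "finite (S \<inter> (J \<times> UNIV))"
          unfolding eq using J fin by auto
        then have "finite (\<Union>\<C> \<inter> (S \<inter> (J \<times> UNIV)))" by blast
        then obtain D where D: "D \<in> \<C>" "\<Union>\<C> \<inter> (S \<inter> (J \<times> UNIV)) \<subseteq> D"
          using finite_subset_Union_chain[OF _ _ False ch] by (metis Int_lower1)
        have "(S - \<Union>\<C>) `` J = (S - D) `` J"
          using D by blast
        moreover have "card J \<le> card ((S - D) `` J)"
          using D sub J by (auto simp: \<D>_def H_def)
        ultimately show "card J \<le> card ((S - \<Union>\<C>) `` J)" by simp
      qed
    qed
    then show "\<Union>\<C> \<in> \<D>" using sub by (auto simp: \<D>_def)
  qed
  then obtain M where M: "M \<in> \<D>" "\<And>X. X \<in> \<D> \<Longrightarrow> M \<subseteq> X \<Longrightarrow> X = M" by blast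
  show thesis
  proof
    show "S - M \<subseteq> S" by blast
    show "card J \<le> card ((S - M) `` J)" if "finite J" "J \<subseteq> I" for J
      using M(1) that by (auto simp: \<D>_def H_def)
    show "\<exists>J. finite J \<and> J \<subseteq> I \<and> card ((S - M - {p}) `` J) < card J" if p: "p \<in> S - M" for p
    proof -
      have "insert p M \<notin> \<D>" using M(2)[of "insert p M"] p by blast
      moreover have "insert p M \<subseteq> S" using M(1) p by (auto simp: \<D>_def)
      ultimately have "\<not> H (S - insert p M)" by (simp add: \<D>_def)
      moreover have "S - insert p M = S - M - {p}" by blast
      ultimately show ?thesis by (auto simp: H_def not_le)
    qed
  qed
qed

text \<open>
  Rado's proof of the marriage theorem for infinitely many finite sets: a minimal subsystem with
  Hall's condition is a function, and Hall's condition for pairs of indices makes it injective.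
\<close>
theorem hall_infinite:
  fixes S :: "('a \<times> 'b) set"
  assumes fin: "\<And>i. i \<in> I \<Longrightarrow> finite (S `` {i})"
    and hall: "\<And>J. finite J \<Longrightarrow> J \<subseteq> I \<Longrightarrow> card J \<le> card (S `` J)"
  shows "\<exists>f. inj_on f I \<and> (\<forall>i\<in>I. (i, f i) \<in> S)"
proof -
  obtain R where R: "R \<subseteq> S" "\<And>J. finite J \<Longrightarrow> J \<subseteq> I \<Longrightarrow> card J \<le> card (R `` J)"
    "\<And>p. p \<in> R \<Longrightarrow> \<exists>J. finite J \<and> J \<subseteq> I \<and> card ((R - {p}) `` J) < card J"
    using hall_minimal_system[of I S, OF fin hall] by metis
  have finR: "finite (Q `` J)" if "Q \<subseteq> R" "finite J" "J \<subseteq> I" for J Q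
  proof (rule finite_subset)
    show "Q `` J \<subseteq> (\<Union>i\<in>J. S `` {i})" using that R(1) by auto
  qed (use that fin in auto)
  \<comment> \<open>In a minimal system every index keeps exactly one value, so the system is the graph of a matching.\<close>
  have unique: "x = y" if xy: "(i, x) \<in> R" "(i, y) \<in> R" for i x y
  proof (rule ccontr)
    assume "x \<noteq> y"
    have violated: "\<exists>J. finite J \<and> J \<subseteq> I \<and> card ((R - {(i, u)}) `` J) < card J \<and> i \<in> J"
      if u: "(i, u) \<in> R" for u
    proof -
      obtain J where J: "finite J" "J \<subseteq> I" "card ((R - {(i, u)}) `` J) < card J"
        using R(3)[OF u] by blast
      moreover have "i \<in> J"
      proof (rule ccontr)
        assume "i \<notin> J"
        then have "(R - {(i, u)}) `` J = R `` J" by auto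
        with J R(2)[of J] show False by simp
      qed
      ultimately show ?thesis by blast
    qed
    obtain J K where J: "finite J" "J \<subseteq> I" "card ((R - {(i, x)}) `` J) < card J" "i \<in> J"
      and K: "finite K" "K \<subseteq> I" "card ((R - {(i, y)}) `` K) < card K" "i \<in> K"
      using violated xy by meson
    \<comment> \<open>Both deletions violate Hall's condition; submodularity of the cardinality makes this impossible.\<close>
    let ?X = "(R - {(i, x)}) `` J" and ?Y = "(R - {(i, y)}) `` K"
    have finXY: "finite ?X" "finite ?Y" using finR J K by (meson Diff_subset)+
    have "card (J \<union> K) \<le> card (R `` (J \<union> K))" using R(2) J K by simp
    also have "\<dots> \<le> card (?X \<union> ?Y)"
      using \<open>x \<noteq> y\<close> J(4) K(4) finXY by (intro card_mono) auto
    finally have 1: "card (J \<union> K) \<le> card (?X \<union> ?Y)" .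
    have "card (J \<inter> K - {i}) \<le> card (R `` (J \<inter> K - {i}))"
      by (rule R(2)) (use J in auto)
    also have "\<dots> \<le> card (?X \<inter> ?Y)"
      using finXY by (intro card_mono) auto
    finally have 2: "card (J \<inter> K) \<le> card (?X \<inter> ?Y) + 1"
      using J K by (simp add: card_Diff_singleton)
    show False
      using 1 2 card_Un_Int[OF finXY] card_Un_Int[OF J(1) K(1)] J(3) K(3) by linarith
  qed
  have ex: "\<exists>x. (i, x) \<in> R" if "i \<in> I" for i
  proof -
    have "1 \<le> card (R `` {i})" using R(2)[of "{i}"] that by simp
    then have "R `` {i} \<noteq> {}" by (metis card.empty not_one_le_zero)
    then show ?thesis by blast
  qed
  define f where "f i = (SOME x. (i, x) \<in> R)" for i
  have f: "(i, f i) \<in> R" if "i \<in> I" for i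
    using someI_ex[OF ex[OF that]] by (simp add: f_def)
  show ?thesis
  proof (intro exI conjI ballI)
    show "(i, f i) \<in> S" if "i \<in> I" for i using f[OF that] R(1) by blast
    show "inj_on f I"
    proof (rule inj_onI, rule ccontr)
      fix i j assume ij: "i \<in> I" "j \<in> I" "f i = f j" "i \<noteq> j"
      have "R `` {i, j} = {f i}"
        using f[OF ij(1)] f[OF ij(2)] unique ij(3) by auto
      then show False using R(2)[of "{i, j}"] ij by simp
    qed
  qed
qed

text \<open>
  Hall's theorem gives injections in both directions along \<open>S\<close>. The Cantor--Bernstein construction
  combines them, and the resulting bijection uses only edges of the two injections.
\<close>
theorem perfect_matching_infinite:
  fixes S :: "('a \<times> 'b) set"
  assumes sub: "S \<subseteq> I \<times> K"
    and fin: "\<And>i. i \<in> I \<Longrightarrow> finite (S `` {i})" "\<And>k. k \<in> K \<Longrightarrow> finite (S\<inverse> `` {k})"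
    and hall: "\<And>J. finite J \<Longrightarrow> J \<subseteq> I \<Longrightarrow> card J \<le> card (S `` J)"
      "\<And>J. finite J \<Longrightarrow> J \<subseteq> K \<Longrightarrow> card J \<le> card (S\<inverse> `` J)"
  obtains h where "bij_betw h I K" "\<And>i. i \<in> I \<Longrightarrow> (i, h i) \<in> S"
proof -
  obtain f where f: "inj_on f I" "\<forall>i\<in>I. (i, f i) \<in> S"
    using hall_infinite[of I S, OF fin(1) hall(1)] by blast
  obtain g where g: "inj_on g K" "\<forall>k\<in>K. (k, g k) \<in> S\<inverse>"
    using hall_infinite[of K "S\<inverse>", OF fin(2) hall(2)] by blast
  \<comment> \<open>On \<open>X\<close> follow \<open>f\<close>; off \<open>X\<close> every point is a value of \<open>g\<close> and is sent back along it.\<close>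
  define X where "X = lfp (\<lambda>X. I - g ` (K - f ` X))"
  have "mono (\<lambda>X. I - g ` (K - f ` X))" by (rule monoI) blast
  then have X: "X = I - g ` (K - f ` X)"
    unfolding X_def by (rule lfp_unfold)
  have gI: "g k \<in> I" if "k \<in> K" for k using g(2) that sub by blast
  have fK: "f i \<in> K" if "i \<in> I" for i using f(2) that sub by blast
  have XI: "X \<subseteq> I" by (subst X) blast
  have "I - X = I - (I - g ` (K - f ` X))" using X by (rule arg_cong)
  also have "\<dots> = g ` (K - f ` X)" using gI by blast
  finally have compl: "I - X = g ` (K - f ` X)" .
  define h where "h i = (if i \<in> X then f i else inv_into K g i)" for i
  have hg: "inv_into K g (g k) = k" if "k \<in> K" for k using g(1) that by simp
  show thesis
  proof
    have "bij_betw h X (f ` X)"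
      using f(1) XI by (auto simp: bij_betw_def h_def inj_on_def)
    moreover have "bij_betw h (I - X) (K - f ` X)"
      unfolding compl bij_betw_def
    proof
      have out: "g k \<notin> X" if "k \<in> K - f ` X" for k using compl that by blast
      show "inj_on h (g ` (K - f ` X))"
        using out hg by (auto simp: inj_on_def h_def)
      show "h ` g ` (K - f ` X) = K - f ` X"
        unfolding image_image using out hg by (simp add: h_def cong: image_cong_simp)
    qed
    ultimately have "bij_betw h (X \<union> (I - X)) (f ` X \<union> (K - f ` X))"
      by (rule bij_betw_combine) blast
    moreover have "X \<union> (I - X) = I" "f ` X \<union> (K - f ` X) = K" using XI fK by auto
    ultimately show "bij_betw h I K" by simp
    show "(i, h i) \<in> S" if i: "i \<in> I" for i
    proof (cases "i \<in> X")
      case True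
      then show ?thesis using f(2) i by (simp add: h_def)
    next
      case False
      then have "i \<in> g ` (K - f ` X)" using i compl by blast
      then obtain k where "k \<in> K" "i = g k" by blast
      then show ?thesis using False g(2) hg by (simp add: h_def)
    qed
  qed
qed

section \<open>The golden ratio and the excess of a tile\<close>

lemma golden_gt_1: "golden > 1"
  by (simp add: golden_def)

lemma golden_less_2: "golden < 2"
proof -
  have "sqrt 5 < sqrt 9" by (subst real_sqrt_less_iff) simp
  also have "sqrt 9 = 3" by (rule real_sqrt_unique) auto
  finally show ?thesis by (simp add: golden_def)
qed

lemma golden_square: "golden\<^sup>2 = golden + 1"
  by (simp add: golden_def power2_eq_square field_simps)

lemma inverse_golden: "1 / golden = golden - 1"
  using golden_square golden_gt_1 by (simp add: field_simps power2_eq_square)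

lemma inverse_golden_square: "1 / golden\<^sup>2 = 2 - golden"
proof -
  have "1 / golden\<^sup>2 = (1 / golden)\<^sup>2" by (simp add: power_divide)
  also have "\<dots> = 2 - golden"
    unfolding inverse_golden using golden_square by (simp add: power2_eq_square algebra_simps)
  finally show ?thesis .
qed

text \<open>
  Write a function of the tile type as the pair of its values at acute and obtuse tiles.
  Summation over the children of a tile acts on such pairs by the matrix with rows
  \<open>(2, 1)\<close> and \<open>(1, 1)\<close>, whose eigenvalues are \<open>\<phi>\<^sup>2\<close>, with the areas \<open>(\<phi>, 1)\<close> as eigenfunction, and
  \<open>\<phi>\<close> to the power \<open>-2\<close>, with eigenfunction \<open>(-1, \<phi>)\<close>. The constant function \<open>(1, 1)\<close> is the sum of
  a multiple of the former and \<open>excess_unit\<close> times the latter; its value is \<open>1 / (\<phi>\<^sup>2 \<surd>5)\<close>.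
\<close>
definition excess_unit :: real where
  "excess_unit = (golden - 1) / (1 + golden\<^sup>2)"

lemma excess_unit_pos: "excess_unit > 0"
  using golden_gt_1 by (simp add: excess_unit_def add_pos_nonneg)

lemma excess_unit_balance: "golden - 1 = excess_unit * (1 + golden\<^sup>2)"
proof -
  have "1 + golden\<^sup>2 \<noteq> 0" using golden_gt_1 by (simp add: add_nonneg_eq_0_iff)
  then show ?thesis by (simp add: excess_unit_def)
qed

text \<open>
  This numerical bound is what makes the neighbours of a set of tiles heavy enough to absorb its
  discrepancy (\<open>tile_density_ge\<close>), already for single tiles.
\<close>
lemma excess_unit_small: "3 * golden * excess_unit \<le> 1"
proof -
  have "1 = golden * (golden - 1)"
    using golden_square by (simp add: algebra_simps power2_eq_square)
  also have "\<dots> = (golden * excess_unit) * (2 + golden)"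
    unfolding excess_unit_balance golden_square by simp
  finally have "1 = (golden * excess_unit) * (2 + golden)" .
  moreover have "(golden * excess_unit) * 3 \<le> (golden * excess_unit) * (2 + golden)"
    using golden_gt_1 excess_unit_pos by (intro mult_left_mono) auto
  ultimately show ?thesis by simp
qed

text \<open>
  The error made when a tile is counted by its area instead of by \<open>1\<close> (\<open>excess_tile_density\<close>); it is
  an eigenfunction of subdivision for the small eigenvalue (\<open>excess_dissect\<close>).
\<close>
fun excess :: "'a tile \<Rightarrow> real" where
  "excess (Acute A B C) = - excess_unit"
| "excess (Obtuse D E F) = golden * excess_unit"

text \<open>
  Area in multiples of the area of an obtuse tile of the same generation.
\<close>
fun relative_area :: "'a tile \<Rightarrow> real" where
  "relative_area (Acute A B C) = golden"
| "relative_area (Obtuse D E F) = 1"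

text \<open>
  The average number of tiles per area of one obtuse tile.
\<close>
definition tile_density :: real where
  "tile_density = 1 - golden * excess_unit"

lemma tile_density_ge: "2 * golden * excess_unit \<le> tile_density" and tile_density_pos: "tile_density > 0"
proof -
  show *: "2 * golden * excess_unit \<le> tile_density"
    using excess_unit_small unfolding tile_density_def by argo
  have "0 < 2 * golden * excess_unit" using golden_gt_1 excess_unit_pos by simp
  with * show "tile_density > 0" by linarith
qed

lemma excess_tile_density: "excess T = 1 - tile_density * relative_area T"
  using excess_unit_balance
  by (cases T) (auto simp: tile_density_def algebra_simps power2_eq_square)

lemma relative_area_ge_1: "relative_area T \<ge> 1"
  using golden_gt_1 by (cases T) auto

section \<open>Dissections and their areas\<close>

definition wedge :: "real^2 \<Rightarrow> real^2 \<Rightarrow> real" where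
  "wedge x y = x$1 * y$2 - x$2 * y$1"

text \<open>
  The area of the obtuse triangles of the generation of the given tile. For an acute triangle this
  is the area divided by \<open>\<phi>\<close>, so all tiles of one generation have the same value.
\<close>
fun area_unit :: "(real^2) tile \<Rightarrow> real" where
  "area_unit (Acute A B C) = \<bar>wedge (B - A) (C - A)\<bar> / (2 * golden)"
| "area_unit (Obtuse D E F) = \<bar>wedge (E - D) (F - D)\<bar> / 2"

text \<open>
  A dissection point divides a side in a known ratio, and the areas of the triangles on either
  side of it are in the same ratio. The identity \<open>1 / \<phi>\<^sup>2 = 1 - 1 / \<phi>\<close> makes the result the same
  for all children.
\<close>
lemma area_unit_dissect:
  assumes "c \<in> dissect T"
  shows "area_unit c = area_unit T / golden\<^sup>2"
proof -
  define s where "s = 1 / golden"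
  have s_eq: "s = golden - 1" unfolding s_def by (rule inverse_golden)
  have s: "s > 0" "s < 1" "1 / golden\<^sup>2 = 1 - s" "1 / golden = s"
    using golden_gt_1 golden_less_2 inverse_golden_square by (simp_all add: s_eq inverse_golden)
  have half: "x / (2 * golden) = x * s / 2" for x
    by (simp add: s_def)
  have square: "x / golden\<^sup>2 = x * (1 - s)" for x
    by (metis s(3) mult.right_neutral times_divide_eq_right)
  have sq: "s * s = 1 - s"
    using golden_square by (simp add: s_eq power2_eq_square algebra_simps)
  show ?thesis
  proof (cases T)
    case T: (Acute A B C)
    let ?w = "wedge (B - A) (C - A)"
    let ?P = "A + s *\<^sub>R (C - A)" and ?Q = "A + (1 - s) *\<^sub>R (B - A)"
    have "wedge (C - B) (?P - B) = (1 - s) * ?w"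
      and "wedge (?Q - B) (?P - B) = - (s * s) * ?w"
      and "wedge (?P - A) (?Q - A) = - (s * (1 - s)) * ?w"
      by (simp_all add: wedge_def algebra_simps)
    then have "area_unit (Acute B C ?P) = area_unit T * (1 - s)"
      "area_unit (Acute B ?Q ?P) = area_unit T * (1 - s)"
      "area_unit (Obtuse A ?P ?Q) = area_unit T * (1 - s)"
      unfolding T area_unit.simps half using s(1,2) by (simp_all add: abs_mult sq)
    moreover have "c \<in> {Acute B C ?P, Acute B ?Q ?P, Obtuse A ?P ?Q}"
      using assms unfolding T dissect.simps Let_def s(3,4) .
    ultimately show ?thesis unfolding square by blast
  next
    case T: (Obtuse D E F)
    let ?w = "wedge (E - D) (F - D)" and ?P = "D + s *\<^sub>R (E - D)"
    have "wedge (?P - D) (F - D) = s * ?w"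
      and "wedge (F - E) (?P - E) = (1 - s) * ?w"
      by (simp_all add: wedge_def algebra_simps)
    then have "area_unit (Acute D ?P F) = area_unit T * (1 - s)"
      "area_unit (Obtuse E F ?P) = area_unit T * (1 - s)"
      unfolding T area_unit.simps half using s(1,2) by (simp_all add: abs_mult sq [symmetric])
    moreover have "c \<in> {Acute D ?P F, Obtuse E F ?P}"
      using assms unfolding T dissect.simps Let_def s(4) .
    ultimately show ?thesis unfolding square by blast
  qed
qed

lemma compact_region: "compact (region T)"
  unfolding region_def by (intro finite_imp_compact_convex_hull) (cases T; simp)

lemma convex_region: "convex (region T)"
  by (simp add: region_def)

lemma region_nonempty: "region T \<noteq> {}"
  by (cases T) (auto simp: region_def)

lemma lmeasurable_region: "region T \<in> lmeasurable"
  by (simp add: compact_region lmeasurable_compact)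

lemma closed_region: "closed (region T)"
  by (simp add: compact_region compact_imp_closed)

lemma measure_region: "measure lebesgue (region T) = relative_area T * area_unit T"
proof -
  have "measure lborel (region T) = relative_area T * area_unit T"
    using golden_gt_1
    by (cases T) (simp_all add: region_def content_triangle wedge_def algebra_simps abs_minus_commute)
  moreover have "measure lebesgue (region T) = measure lborel (region T)"
    by (simp add: borel_compact compact_region)
  ultimately show ?thesis by simp
qed

text \<open>
  The segment from \<open>B\<close> to a point of the opposite side cuts the triangle in two.
\<close>
lemma triangle_split:
  fixes A B C :: "'a::real_vector"
  assumes t: "0 < t" "t < 1"
  shows "convex hull {A, B, C} =
    convex hull {B, C, A + t *\<^sub>R (C - A)} \<union> convex hull {A, A + t *\<^sub>R (C - A), B}"
    (is "?T = ?L \<union> ?R")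
proof
  let ?P = "A + t *\<^sub>R (C - A)"
  have P: "?P = (1 - t) *\<^sub>R A + t *\<^sub>R C" by (simp add: algebra_simps)
  also have "\<dots> \<in> convex hull {A, B, C}"
    using t by (intro convexD convex_convex_hull) (auto intro: hull_inc)
  finally have "?P \<in> ?T" .
  then show "?L \<union> ?R \<subseteq> ?T"
    by (intro Un_least hull_minimal) (auto intro: hull_inc)
  show "?T \<subseteq> ?L \<union> ?R"
  proof
    fix x assume "x \<in> ?T"
    then obtain a b c where x: "x = a *\<^sub>R A + b *\<^sub>R B + c *\<^sub>R C"
      and abc: "0 \<le> a" "0 \<le> b" "0 \<le> c" "a + b + c = 1"
      unfolding convex_hull_3 by blast
    \<comment> \<open>The point lies on the side of \<open>C\<close> of the line through \<open>B\<close> and the dividing point iff \<open>a t \<le> c (1 - t)\<close>.\<close>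
    show "x \<in> ?L \<union> ?R"
    proof (cases "a * t \<le> c * (1 - t)")
      case True
      have "x = b *\<^sub>R B + (c - a * t / (1 - t)) *\<^sub>R C + (a / (1 - t)) *\<^sub>R ?P"
      proof -
        have "(a / (1 - t)) *\<^sub>R ?P = (a / (1 - t) * (1 - t)) *\<^sub>R A + (a / (1 - t) * t) *\<^sub>R C"
          unfolding P by (simp add: scaleR_right_distrib)
        also have "\<dots> = a *\<^sub>R A + (a * t / (1 - t)) *\<^sub>R C" using t by simp
        finally show ?thesis by (simp add: x scaleR_left_diff_distrib)
      qed
      moreover have "0 \<le> c - a * t / (1 - t)" "0 \<le> a / (1 - t)"
        using True t abc by (auto simp: pos_divide_le_eq)
      moreover have "b + (c - a * t / (1 - t)) + a / (1 - t) = 1"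
      proof -
        have "a / (1 - t) - a * t / (1 - t) = (a * (1 - t)) / (1 - t)"
          by (simp add: right_diff_distrib diff_divide_distrib)
        also have "\<dots> = a" using t by simp
        finally show ?thesis using abc by linarith
      qed
      ultimately have "x \<in> ?L" unfolding convex_hull_3 using abc by blast
      then show ?thesis ..
    next
      case False
      have "x = (a - c * (1 - t) / t) *\<^sub>R A + (c / t) *\<^sub>R ?P + b *\<^sub>R B"
      proof -
        have "(c / t) *\<^sub>R ?P = (c / t * (1 - t)) *\<^sub>R A + (c / t * t) *\<^sub>R C"
          unfolding P by (simp add: scaleR_right_distrib)
        also have "\<dots> = (c * (1 - t) / t) *\<^sub>R A + c *\<^sub>R C" using t by simp
        finally show ?thesis by (simp add: x scaleR_left_diff_distrib)
      qed
      moreover have "0 \<le> a - c * (1 - t) / t" "0 \<le> c / t"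
        using False t abc by (auto simp: pos_divide_le_eq)
      moreover have "(a - c * (1 - t) / t) + c / t + b = 1"
      proof -
        have "c / t - c * (1 - t) / t = (c * t) / t"
          by (simp add: right_diff_distrib diff_divide_distrib)
        also have "\<dots> = c" using t by simp
        finally show ?thesis using abc by linarith
      qed
      ultimately have "x \<in> ?R" unfolding convex_hull_3 using abc by blast
      then show ?thesis ..
    qed
  qed
qed

lemma region_dissect: "region T = (\<Union>c\<in>dissect T. region c)"
proof (cases T)
  case T: (Acute A B C)
  have g: "0 < 1 / golden" "1 / golden < 1" "0 < 1 / golden\<^sup>2" "1 / golden\<^sup>2 < 1"
    using golden_gt_1 by (auto simp: power2_eq_square less_1_mult)
  show ?thesis
    using triangle_split[OF g(1,2), of A B C]
      triangle_split[OF g(3,4), of A "A + (1 / golden) *\<^sub>R (C - A)" B]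
    by (auto simp: T region_def Let_def insert_commute)
next
  case T: (Obtuse D E F)
  have g: "0 < 1 / golden" "1 / golden < 1"
    using golden_gt_1 by auto
  show ?thesis
    using triangle_split[OF g(1,2), of D F E]
    by (auto simp: T region_def Let_def insert_commute)
qed

lemma finite_dissect: "finite (dissect T)"
  by (cases T) (simp_all add: Let_def)

text \<open>
  Applied with the dissection point \<open>Q\<close> on \<open>AB\<close>, this separates the two acute children \<open>(B, C, P)\<close>
  and \<open>(B, Q, P)\<close>, so that sums over the set \<open>dissect T\<close> count both.
\<close>
lemma dissect_Acute_distinct:
  assumes "area_unit (Acute A B C) > 0"
  shows "C \<noteq> A + t *\<^sub>R (B - A)"
  using assms by (auto simp: wedge_def)

lemma relative_area_dissect:
  assumes "area_unit T > 0"
  shows "(\<Sum>c\<in>dissect T. relative_area c) = golden\<^sup>2 * relative_area T"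
  using assms dissect_Acute_distinct golden_square
  by (cases T) (auto simp: Let_def power2_eq_square algebra_simps)

lemma excess_dissect:
  assumes "area_unit T > 0"
  shows "(\<Sum>c\<in>dissect T. excess c) = excess T / golden\<^sup>2"
proof -
  have *: "x / golden\<^sup>2 = x * (2 - golden)" for x
    using inverse_golden_square by (metis divide_inverse inverse_eq_divide)
  show ?thesis
  proof (cases T)
    case (Acute A B C)
    then show ?thesis
      unfolding * using assms dissect_Acute_distinct by (auto simp: Let_def algebra_simps)
  next
    case (Obtuse D E F)
    have "golden * excess_unit * (2 - golden) = (2 * golden - golden\<^sup>2) * excess_unit"
      by (simp add: power2_eq_square algebra_simps)
    also have "\<dots> = golden * excess_unit - excess_unit"
      unfolding golden_square by (simp add: algebra_simps)
    finally show ?thesis unfolding * Obtuse by (simp add: Let_def)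
  qed
qed

text \<open>
  A part of a dissection has at most two acute tiles and one obtuse tile, with excess of opposite
  signs and \<open>\<phi> < 2\<close>.
\<close>
lemma excess_subset_dissect:
  assumes "I \<subseteq> dissect T"
  shows "\<bar>\<Sum>c\<in>I. excess c\<bar> \<le> 2 * excess_unit"
proof -
  have fin: "finite I" using assms finite_dissect by (rule finite_subset)
  define Ac where "Ac = {c \<in> I. \<exists>A B C. c = Acute A B C}"
  define Ob where "Ob = {c \<in> I. \<exists>A B C. c = Obtuse A B C}"
  have I: "I = Ac \<union> Ob" "Ac \<inter> Ob = {}"
    unfolding Ac_def Ob_def by (auto, metis tile.exhaust)
  have fin': "finite Ac" "finite Ob" using fin by (auto simp: Ac_def Ob_def)
  obtain a1 a2 b where abc: "Ac \<subseteq> {a1, a2}" "Ob \<subseteq> {b}"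
    using assms unfolding Ac_def Ob_def by (cases T) (auto simp: Let_def; blast)+
  have "card Ac \<le> card {a1, a2}" using abc by (intro card_mono) auto
  then have cA: "card Ac \<le> 2" by (auto simp: card_insert_if split: if_splits)
  have cO: "card Ob \<le> 1" using abc card_mono[of "{b}" Ob] by simp
  have "(\<Sum>c\<in>I. excess c) = real (card Ob) * (golden * excess_unit) - real (card Ac) * excess_unit"
  proof -
    have "(\<Sum>c\<in>Ac. excess c) = (\<Sum>c\<in>Ac. - excess_unit)" by (rule sum.cong) (auto simp: Ac_def)
    moreover have "(\<Sum>c\<in>Ob. excess c) = (\<Sum>c\<in>Ob. golden * excess_unit)"
      by (rule sum.cong) (auto simp: Ob_def)
    ultimately show ?thesis
      unfolding I(1) sum.union_disjoint[OF fin' I(2)] by simp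
  qed
  moreover have "real (card Ac) * excess_unit \<le> 2 * excess_unit" "0 \<le> real (card Ac) * excess_unit"
    using cA excess_unit_pos by auto
  moreover have "real (card Ob) * (golden * excess_unit) \<le> 1 * (2 * excess_unit)"
    "0 \<le> real (card Ob) * (golden * excess_unit)"
    using cO excess_unit_pos golden_gt_1 golden_less_2
    by (intro mult_mono mult_right_mono mult_nonneg_nonneg; simp)+
  ultimately show ?thesis
    unfolding abs_le_iff by (intro conjI; linarith)
qed

text \<open>
  Additivity of the measure forces negligible overlaps. For dissections this replaces an argument
  with separating lines by the computation of areas.
\<close>
lemma negligible_Int_if_measure_additive:
  assumes fin: "finite I" and meas: "\<And>i. i \<in> I \<Longrightarrow> f i \<in> lmeasurable"
    and sum: "(\<Sum>i\<in>I. measure lebesgue (f i)) \<le> measure lebesgue (\<Union>i\<in>I. f i)"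
    and ij: "i \<in> I" "j \<in> I" "i \<noteq> j"
  shows "negligible (f i \<inter> f j)"
proof -
  let ?m = "measure lebesgue" and ?K = "I - {i} - {j}"
  have m: "f i \<in> lmeasurable" "f j \<in> lmeasurable" using meas ij by auto
  have mK: "(\<Union>k\<in>?K. f k) \<in> lmeasurable" using fin meas by (intro fmeasurable.finite_UN) auto
  have "(\<Union>k\<in>I. f k) = (f i \<union> f j) \<union> (\<Union>k\<in>?K. f k)" using ij by blast
  then have "?m (\<Union>k\<in>I. f k) \<le> ?m (f i \<union> f j) + ?m (\<Union>k\<in>?K. f k)"
    using m mK measure_Un_le[of "f i \<union> f j" lebesgue "\<Union>k\<in>?K. f k"] by auto
  also have "?m (\<Union>k\<in>?K. f k) \<le> (\<Sum>k\<in>?K. ?m (f k))"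
    using fin meas by (intro measure_UNION_le) auto
  also have "?m (f i \<union> f j) = ?m (f i) + ?m (f j) - ?m (f i \<inter> f j)"
    using measure_Un3[OF m] by simp
  finally have "?m (\<Union>k\<in>I. f k) \<le> ?m (f i) + ?m (f j) + (\<Sum>k\<in>?K. ?m (f k)) - ?m (f i \<inter> f j)"
    by simp
  moreover have "(\<Sum>k\<in>I. ?m (f k)) = ?m (f i) + ?m (f j) + (\<Sum>k\<in>?K. ?m (f k))"
    using fin ij sum.remove[of I i "\<lambda>k. ?m (f k)"] sum.remove[of "I - {i}" j "\<lambda>k. ?m (f k)"]
    by (metis (no_types, lifting) add.assoc finite_Diff insertE insert_Diff)
  ultimately have "?m (f i \<inter> f j) \<le> 0" using sum by linarith
  then have "?m (f i \<inter> f j) = 0" by (simp add: order_antisym)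
  moreover have "f i \<inter> f j \<in> lmeasurable" using m by (rule fmeasurable.Int)
  ultimately show ?thesis by (simp only: negligible_iff_measure0)
qed

lemma negligible_Int_dissect:
  assumes "area_unit T > 0" "c \<in> dissect T" "c' \<in> dissect T" "c \<noteq> c'"
  shows "negligible (region c \<inter> region c')"
proof (rule negligible_Int_if_measure_additive[OF finite_dissect _ _ assms(2-4)])
  show "region c \<in> lmeasurable" for c by (rule lmeasurable_region)
  have "(\<Sum>c\<in>dissect T. measure lebesgue (region c)) =
      (\<Sum>c\<in>dissect T. relative_area c * (area_unit T / golden\<^sup>2))"
    by (rule sum.cong) (simp_all add: measure_region area_unit_dissect)
  also have "\<dots> = (golden\<^sup>2 * relative_area T) * (area_unit T / golden\<^sup>2)"
    unfolding relative_area_dissect[OF assms(1), symmetric] by (rule sum_distrib_right [symmetric])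
  also have "\<dots> = measure lebesgue (region T)"
    using golden_gt_1 by (simp add: measure_region)
  finally show "(\<Sum>c\<in>dissect T. measure lebesgue (region c))
      \<le> measure lebesgue (\<Union>c\<in>dissect T. region c)"
    unfolding region_dissect[of T, symmetric] by simp
qed

lemma not_negligible_region: "area_unit T > 0 \<Longrightarrow> \<not> negligible (region T)"
  using relative_area_ge_1[of T] by (auto simp: negligible_iff_measure measure_region)

section \<open>Iterated dissections\<close>

definition descendants :: "nat \<Rightarrow> (real^2) tile \<Rightarrow> (real^2) tile set" where
  "descendants m T = (penrose_H ^^ m) {T}"

lemma penrose_H_power: "(penrose_H ^^ m) X = (\<Union>T\<in>X. descendants m T)"
proof (induction m arbitrary: X)
  case (Suc m)
  have "(penrose_H ^^ Suc m) X = (penrose_H ^^ m) (penrose_H X)" for X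
    by (simp add: funpow_swap1)
  then show ?case unfolding descendants_def by (simp add: Suc) (simp add: penrose_H_def)
qed (simp add: descendants_def)

lemma descendants_0 [simp]: "descendants 0 T = {T}"
  by (simp add: descendants_def)

lemma descendants_Suc: "descendants (Suc m) T = (\<Union>c\<in>dissect T. descendants m c)"
proof -
  have "descendants (Suc m) T = (penrose_H ^^ m) (penrose_H {T})"
    by (simp add: descendants_def funpow_swap1)
  then show ?thesis by (simp add: penrose_H_power penrose_H_def)
qed

lemma finite_descendants: "finite (descendants m T)"
  by (induction m arbitrary: T) (auto simp: descendants_Suc finite_dissect)

lemma region_descendants: "(\<Union>d\<in>descendants m T. region d) = region T"
proof (induction m arbitrary: T)
  case (Suc m)
  have "(\<Union>d\<in>descendants (Suc m) T. region d) = (\<Union>c\<in>dissect T. \<Union>d\<in>descendants m c. region d)"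
    by (auto simp: descendants_Suc)
  also have "\<dots> = region T" unfolding Suc by (rule region_dissect [symmetric])
  finally show ?case .
qed simp

lemma area_unit_descendants:
  "d \<in> descendants m T \<Longrightarrow> area_unit d = area_unit T / golden ^ (2 * m)"
proof (induction m arbitrary: T)
  case (Suc m)
  then obtain c where c: "c \<in> dissect T" "d \<in> descendants m c" by (auto simp: descendants_Suc)
  show ?case
    using Suc.IH[OF c(2)] area_unit_dissect[OF c(1)] by (simp add: power2_eq_square)
qed simp

lemma area_unit_descendants_pos:
  assumes "area_unit T > 0" "d \<in> descendants m T" shows "area_unit d > 0"
  using assms golden_gt_1 by (simp add: area_unit_descendants[OF assms(2)])

lemma negligible_Int_descendants:
  assumes "area_unit T > 0" "d \<in> descendants m T" "d' \<in> descendants m T" "d \<noteq> d'"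
  shows "negligible (region d \<inter> region d')"
  using assms
proof (induction m arbitrary: T)
  case (Suc m)
  obtain c c' where c: "c \<in> dissect T" "d \<in> descendants m c" and c': "c' \<in> dissect T" "d' \<in> descendants m c'"
    using Suc.prems by (auto simp: descendants_Suc)
  show ?case
  proof (cases "c = c'")
    case True
    have "area_unit c > 0" using area_unit_dissect[OF c(1)] Suc.prems(1) golden_gt_1 by simp
    then show ?thesis using Suc.IH Suc.prems c c' True by blast
  next
    case False
    have "region d \<inter> region d' \<subseteq> region c \<inter> region c'"
      using region_descendants c(2) c'(2) by blast
    then show ?thesis
      using negligible_Int_dissect[OF Suc.prems(1) c(1) c'(1) False] negligible_subset by blast
  qed
qed simp

text \<open>
  A common descendant would have positive area inside the negligible overlap of the two children.
\<close>
lemma disjoint_descendants: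
  assumes "area_unit T > 0" "c \<in> dissect T" "c' \<in> dissect T" "c \<noteq> c'"
  shows "descendants m c \<inter> descendants m c' = {}"
proof (rule ccontr)
  assume "\<not> ?thesis"
  then obtain d where d: "d \<in> descendants m c" "d \<in> descendants m c'" by blast
  have "region d \<subseteq> region c \<inter> region c'"
    using region_descendants d by blast
  then have "negligible (region d)"
    using negligible_Int_dissect[OF assms] negligible_subset by blast
  moreover have "d \<in> descendants (Suc m) T" using d assms by (auto simp: descendants_Suc)
  ultimately show False
    using not_negligible_region area_unit_descendants_pos[OF assms(1)] by blast
qed

section \<open>Discrepancy inside a dissected triangle\<close>

definition touches :: "(real^2) tile \<Rightarrow> (real^2) tile \<Rightarrow> bool" where
  "touches T T' \<longleftrightarrow> region T \<inter> region T' \<noteq> {}"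

lemma touches_refl: "touches T T"
  by (simp add: touches_def region_nonempty)

lemma touches_sym: "touches T T' \<longleftrightarrow> touches T' T"
  by (auto simp: touches_def)

text \<open>
  The tiles of \<open>X\<close> just outside of \<open>F\<close>. This outer boundary is used because the neighbours
  are what will be added to \<open>F\<close> when Hall's condition is checked.
\<close>
definition rim :: "(real^2) tile set \<Rightarrow> (real^2) tile set \<Rightarrow> (real^2) tile set" where
  "rim F X = {T \<in> X - F. \<exists>T'\<in>X \<inter> F. touches T' T}"

text \<open>
  The triangle is connected, so it is not the disjoint union of the closed regions covered by the
  tiles in \<open>F\<close> and by the other ones.
\<close>
lemma rim_descendants_nonempty:
  assumes "descendants m T \<inter> F \<noteq> {}" "descendants m T - F \<noteq> {}"
  shows "rim F (descendants m T) \<noteq> {}"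
proof -
  let ?X = "descendants m T"
  let ?A = "\<Union>d\<in>?X \<inter> F. region d" and ?B = "\<Union>d\<in>?X - F. region d"
  have AB: "?A \<union> ?B = region T" using region_descendants[of m T] by blast
  have closed: "closed ?A" "closed ?B"
    using finite_descendants closed_region by (auto intro!: closed_UN)
  have "?A \<inter> region T \<noteq> {}" "?B \<inter> region T \<noteq> {}"
    using assms region_nonempty AB by blast+
  moreover have "connected (region T)" using convex_region by (rule convex_connected)
  ultimately have "?A \<inter> ?B \<inter> region T \<noteq> {}"
    using connected_closedD[OF _ _ _ closed, of "region T"] AB by (metis order_refl)
  then show ?thesis by (auto simp: rim_def touches_def)
qed

lemma sum_descendants_Suc:
  assumes "area_unit T > 0"
  shows "(\<Sum>d\<in>descendants (Suc m) T \<inter> F. g d) = (\<Sum>c\<in>dissect T. \<Sum>d\<in>descendants m c \<inter> F. g d)"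
proof -
  have "descendants (Suc m) T \<inter> F = (\<Union>c\<in>dissect T. descendants m c \<inter> F)"
    by (auto simp: descendants_Suc)
  moreover have "(\<Sum>d\<in>(\<Union>c\<in>dissect T. descendants m c \<inter> F). g d) =
      (\<Sum>c\<in>dissect T. \<Sum>d\<in>descendants m c \<inter> F. g d)"
    using disjoint_descendants[OF assms, of _ _ m] finite_descendants finite_dissect
    by (intro sum.UNION_disjoint ballI impI finite_Int disjI1) blast+
  ultimately show ?thesis by simp
qed

lemma area_unit_dissect_pos: "area_unit T > 0 \<Longrightarrow> c \<in> dissect T \<Longrightarrow> area_unit c > 0"
  using area_unit_dissect golden_gt_1 by simp

lemma excess_descendants:
  assumes "area_unit T > 0"
  shows "(\<Sum>d\<in>descendants m T. excess d) = excess T / golden ^ (2 * m)"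
  using assms
proof (induction m arbitrary: T)
  case (Suc m)
  have "(\<Sum>d\<in>descendants (Suc m) T. excess d) = (\<Sum>c\<in>dissect T. \<Sum>d\<in>descendants m c. excess d)"
    using sum_descendants_Suc[OF Suc.prems, of excess m UNIV] by simp
  also have "\<dots> = (\<Sum>c\<in>dissect T. excess c / golden ^ (2 * m))"
    using Suc area_unit_dissect_pos by (intro sum.cong) auto
  also have "\<dots> = excess T / golden\<^sup>2 / golden ^ (2 * m)"
    using excess_dissect[OF Suc.prems] by (simp flip: sum_divide_distrib)
  finally show ?case by (simp add: power2_eq_square)
qed simp

text \<open>
  The heart of the proof. Call a subtriangle mixed if \<open>F\<close> contains some but not all of its tiles.
  In the hierarchy of subtriangles, the discrepancy of \<open>F\<close> is the sum of the excess of the largest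
  subtriangles that lie in \<open>F\<close>. The parent of each of them is mixed, so it contains a rim tile, and
  distinct mixed triangles of one generation have disjoint rims. Since the excess of a triangle \<open>m\<close>
  generations up is proportional to \<open>\<phi>\<close> to the power \<open>-2 m\<close>, the contributions of the generations
  form a convergent series times the size of the rim.
  
  The subtracted term makes this an induction: it is the part of the series that is reserved for
  the generations still to come.
\<close>
lemma excess_mixed_descendants:
  assumes "area_unit T > 0" "descendants m T \<inter> F \<noteq> {}" "descendants m T - F \<noteq> {}"
  shows "\<bar>\<Sum>d\<in>descendants m T \<inter> F. excess d\<bar> \<le>
    2 * golden * excess_unit * card (rim F (descendants m T)) - 2 * golden * excess_unit / golden ^ (2 * m)"
  using assms
proof (induction m arbitrary: T)
  case 0
  then show ?case by auto
next
  case (Suc m)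
  define X where "X c = descendants m c" for c
  define v where "v c = (\<Sum>d\<in>X c \<inter> F. excess d)" for c
  define M where "M = {c \<in> dissect T. X c \<inter> F \<noteq> {} \<and> X c - F \<noteq> {}}"
  define I where "I = {c \<in> dissect T. X c \<subseteq> F}"
  define q where "q = golden ^ (2 * m)"
  let ?C = "2 * golden * excess_unit" and ?R = "rim F (descendants (Suc m) T)"
  have q: "q \<ge> 1" using golden_gt_1 by (simp add: q_def)
  have fin: "finite M" "finite I" "finite (dissect T)"
    using finite_dissect by (simp_all add: M_def I_def)
  have finR: "finite ?R"
    by (rule finite_subset[OF _ finite_descendants[of "Suc m" T]]) (auto simp: rim_def)
  have v_I: "v c = excess c / q" if "c \<in> I" for c
    using that excess_descendants[OF area_unit_dissect_pos[OF Suc.prems(1)], of c m]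
    by (simp add: I_def v_def X_def q_def Int_absorb2)
  have "(\<Sum>d\<in>descendants (Suc m) T \<inter> F. excess d) = (\<Sum>c\<in>dissect T. v c)"
    using sum_descendants_Suc[OF Suc.prems(1)] by (simp add: v_def X_def)
  also have "\<dots> = (\<Sum>c\<in>M \<union> I. v c)"
    using fin
  proof (intro sum.mono_neutral_right ballI)
    fix c assume "c \<in> dissect T - (M \<union> I)"
    then have "X c \<inter> F = {}" unfolding M_def I_def by blast
    then show "v c = 0" by (simp add: v_def)
  qed (auto simp: M_def I_def)
  also have "\<dots> = (\<Sum>c\<in>M. v c) + (\<Sum>c\<in>I. v c)"
    using fin by (intro sum.union_disjoint) (auto simp: M_def I_def)
  finally have split: "(\<Sum>d\<in>descendants (Suc m) T \<inter> F. excess d) = (\<Sum>c\<in>M. v c) + (\<Sum>c\<in>I. v c)" .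
  have "(\<Sum>c\<in>I. v c) = (\<Sum>c\<in>I. excess c) / q"
    using v_I by (simp add: sum_divide_distrib)
  moreover have "\<bar>\<Sum>c\<in>I. excess c\<bar> \<le> 2 * excess_unit"
    by (rule excess_subset_dissect[of I T]) (auto simp: I_def)
  ultimately have pure: "\<bar>\<Sum>c\<in>I. v c\<bar> \<le> 2 * excess_unit / q"
    using q by (simp add: divide_right_mono)
  have "(\<Sum>c\<in>M. card (rim F (X c))) = card (\<Union>c\<in>M. rim F (X c))"
  proof (rule card_UN_disjoint [symmetric])
    have "rim F (X c) \<subseteq> X c" for c by (auto simp: rim_def)
    moreover have "X c \<inter> X c' = {}" if "c \<in> M" "c' \<in> M" "c \<noteq> c'" for c c'
      unfolding X_def by (rule disjoint_descendants[OF Suc.prems(1)]) (use that in \<open>auto simp: M_def\<close>)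
    ultimately show "\<forall>c\<in>M. \<forall>c'\<in>M. c \<noteq> c' \<longrightarrow> rim F (X c) \<inter> rim F (X c') = {}" by blast
    show "\<forall>c\<in>M. finite (rim F (X c))"
      using finite_descendants by (simp add: rim_def X_def)
  qed (rule fin)
  also have "\<dots> \<le> card ?R"
    using finR by (intro card_mono) (auto simp: rim_def X_def M_def descendants_Suc)
  finally have "real (\<Sum>c\<in>M. card (rim F (X c))) \<le> real (card ?R)" by (rule of_nat_mono)
  then have cards: "(\<Sum>c\<in>M. real (card (rim F (X c)))) \<le> real (card ?R)"
    unfolding of_nat_sum .
  have C_pos: "?C > 0" using golden_gt_1 excess_unit_pos by simp
  \<comment> \<open>The reserve shrinks exactly by the largest possible contribution of the children that lie in \<open>F\<close>, as \<open>\<phi> - 1 = 1 / \<phi>\<close>.\<close>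
  have step: "?C / golden ^ (2 * Suc m) = ?C / q - 2 * excess_unit / q"
  proof -
    have "?C / golden ^ (2 * Suc m) = 2 * excess_unit * (1 / golden) / q"
      using golden_gt_1 by (simp add: q_def)
    then show ?thesis by (simp add: inverse_golden algebra_simps diff_divide_distrib)
  qed
  show ?case
  proof (cases "M = {}")
    case True
    \<comment> \<open>No child is mixed, so a single rim tile has to pay for this and all later generations.\<close>
    have "rim F (descendants (Suc m) T) \<noteq> {}"
      by (rule rim_descendants_nonempty) (use Suc.prems in auto)
    then have "card ?R \<ge> 1"
      using finR by (simp add: Suc_le_eq card_gt_0_iff)
    then have "?C * 1 \<le> ?C * card ?R" using C_pos by (intro mult_left_mono) auto
    moreover have "?C / q \<le> ?C" using q C_pos mult_left_mono[of 1 q ?C] by (simp add: pos_divide_le_eq)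
    ultimately have "2 * excess_unit / q \<le> ?C * card ?R - (?C / q - 2 * excess_unit / q)" by simp
    with pure have "\<bar>\<Sum>c\<in>I. v c\<bar> \<le> ?C * card ?R - (?C / q - 2 * excess_unit / q)"
      by (rule order_trans)
    then show ?thesis unfolding split step by (simp only: True sum.empty add_0)
  next
    case False
    have "\<bar>\<Sum>c\<in>M. v c\<bar> \<le> (\<Sum>c\<in>M. ?C * card (rim F (X c)) - ?C / q)"
    proof (rule order_trans[OF sum_abs], rule sum_mono)
      fix c assume c: "c \<in> M"
      then have "area_unit c > 0" "descendants m c \<inter> F \<noteq> {}" "descendants m c - F \<noteq> {}"
        using area_unit_dissect_pos[OF Suc.prems(1)] by (auto simp: M_def X_def)
      then show "\<bar>v c\<bar> \<le> ?C * card (rim F (X c)) - ?C / q"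
        unfolding v_def X_def q_def by (rule Suc.IH)
    qed
    also have "\<dots> = ?C * (\<Sum>c\<in>M. real (card (rim F (X c)))) - real (card M) * (?C / q)"
      by (simp add: sum_subtractf sum_distrib_left)
    also have "\<dots> \<le> ?C * card ?R - 1 * (?C / q)"
    proof (intro diff_mono mult_left_mono mult_right_mono)
      show "1 \<le> real (card M)" using False fin by (simp add: Suc_leI card_gt_0_iff)
      show "?C / q \<ge> 0" using C_pos q by simp
      show "?C \<ge> 0" using C_pos by simp
    qed (rule cards)
    finally have "\<bar>\<Sum>c\<in>M. v c\<bar> + \<bar>\<Sum>c\<in>I. v c\<bar> \<le> (?C * card ?R - 1 * (?C / q)) + 2 * excess_unit / q"
      using pure by (rule add_mono)
    with abs_triangle_ineq have "\<bar>(\<Sum>c\<in>M. v c) + (\<Sum>c\<in>I. v c)\<bar> \<le>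
        (?C * card ?R - 1 * (?C / q)) + 2 * excess_unit / q"
      by (rule order_trans)
    then show ?thesis unfolding split step by (simp only: mult_1 diff_diff_eq2 diff_add_eq)
  qed
qed

section \<open>Prototiles and inflation\<close>

lemma affine_dissect:
  assumes "\<And>x y s. f (x + s *\<^sub>R (y - x)) = f x + s *\<^sub>R (f y - f x)"
  shows "dissect (map_tile f T) = map_tile f ` dissect T"
  by (cases T) (auto simp: Let_def assms)

lemma affine_descendants:
  assumes "\<And>x y s. f (x + s *\<^sub>R (y - x)) = f x + s *\<^sub>R (f y - f x)"
  shows "descendants m (map_tile f T) = map_tile f ` descendants m T"
proof (induction m arbitrary: T)
  case (Suc m)
  show ?case by (simp add: descendants_Suc affine_dissect[OF assms] Suc image_UN)
qed simp

text \<open>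
  Inflating after each subdivision is the same as inflating once at the beginning. In this form the
  supertiles of all generations are triangles in the plane of the final patch.
\<close>
lemma inflated_H_power:
  "(inflated_H ^^ m) {S} = descendants m (map_tile (\<lambda>x. golden ^ m *\<^sub>R x) S)"
proof (induction m)
  case 0
  show ?case by (simp add: tile.map_ident)
next
  case (Suc m)
  let ?S = "map_tile (\<lambda>x. golden ^ m *\<^sub>R x) S"
  have "(inflated_H ^^ Suc m) {S} = map_tile (\<lambda>x. golden *\<^sub>R x) ` penrose_H (descendants m ?S)"
    by (simp add: Suc inflated_H_def)
  also have "penrose_H (descendants m ?S) = descendants (Suc m) ?S"
    by (simp add: descendants_def)
  also have "map_tile (\<lambda>x. golden *\<^sub>R x) ` \<dots> =
      descendants (Suc m) (map_tile (\<lambda>x. golden *\<^sub>R x) ?S)"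
    by (rule affine_descendants [symmetric]) (simp add: algebra_simps)
  also have "map_tile (\<lambda>x. golden *\<^sub>R x) ?S = map_tile (\<lambda>x. golden ^ Suc m *\<^sub>R x) S"
    by (simp add: tile.map_comp o_def)
  finally show ?case .
qed

lemma area_unit_linear:
  assumes "\<And>x y. f x - f y = g (x - y)" and "\<And>x y. \<bar>wedge (g x) (g y)\<bar> = k * \<bar>wedge x y\<bar>"
  shows "area_unit (map_tile f T) = k * area_unit T"
  by (cases T) (simp_all add: assms)

lemma area_unit_translate: "area_unit (translate_tile v T) = area_unit T"
  unfolding translate_tile_def
  using area_unit_linear[of "\<lambda>x. v + x" "\<lambda>x. x" 1] by simp

lemma region_translate: "region (translate_tile v T) = (+) v ` region T"
  by (simp add: region_def translate_tile_def tile.set_map convex_hull_translation)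

text \<open>
  With \<open>c = cos (\<pi> / 5)\<close>, the double and triple angle formulas at \<open>2 \<pi> / 5\<close> and \<open>3 \<pi> / 5 = \<pi> - 2 \<pi> / 5\<close>
  give a cubic equation for \<open>c\<close> with the extraneous root \<open>-1\<close>.
\<close>
lemma golden_eq_cos: "golden = 2 * cos (pi / 5)"
proof -
  define c where "c = cos (pi / 5)"
  have c: "c > 0" unfolding c_def by (rule cos_gt_zero) auto
  have double: "cos (2 * (pi / 5)) = 2 * c\<^sup>2 - 1"
    by (simp only: cos_double_cos c_def)
  have triple: "cos (3 * (pi / 5)) = 4 * c ^ 3 - 3 * c"
    by (simp only: cos_treble_cos c_def)
  have "cos (3 * (pi / 5)) = cos (pi - 2 * (pi / 5))" by (rule arg_cong[of _ _ cos]) simp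
  also have "\<dots> = - cos (2 * (pi / 5))" by (rule cos_pi_minus)
  finally have "4 * c ^ 3 - 3 * c = - (2 * c\<^sup>2 - 1)" unfolding double triple .
  then have "(c + 1) * (4 * c\<^sup>2 - 2 * c - 1) = 0"
    by (simp add: algebra_simps power2_eq_square power3_eq_cube)
  then have "(2 * c)\<^sup>2 = 2 * c + 1" using c by (simp add: power2_eq_square)
  then have "(golden - 2 * c) * (golden + 2 * c - 1) = 0"
    using golden_square by (simp add: algebra_simps power2_eq_square)
  moreover have "golden + 2 * c - 1 > 0" using golden_gt_1 c by simp
  ultimately show ?thesis by (simp add: c_def)
qed

text \<open>
  The area of the obtuse prototile, \<open>2 \<phi> sin (\<pi> / 5)\<close>, in the form suggested by the acute one.
\<close>
definition prototile_unit :: real where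
  "prototile_unit = 2 * sin (2 * pi / 5)"

lemma prototile_unit_pos: "prototile_unit > 0"
  unfolding prototile_unit_def by (intro mult_pos_pos sin_gt_zero) auto

lemma area_unit_base: "area_unit base_acute = prototile_unit" "area_unit base_obtuse = prototile_unit"
proof -
  have pos: "sin (2 * pi / 5) > 0" "sin (pi / 5) > 0" by (intro sin_gt_zero; simp)+
  show "area_unit base_acute = prototile_unit"
  proof -
    let ?A = "(2 * golden) *\<^sub>R vector [cos (2 * pi / 5), sin (2 * pi / 5)] :: real^2"
    have "wedge (0 - ?A) (vector [2, 0] - ?A) = 2 * golden * (2 * sin (2 * pi / 5))"
      by (simp add: wedge_def algebra_simps)
    then show ?thesis
      unfolding base_acute_def area_unit.simps prototile_unit_def
      using pos golden_gt_1 by (simp add: abs_mult)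
  qed
  have "sin (2 * pi / 5) = 2 * sin (pi / 5) * cos (pi / 5)"
    using sin_double[of "pi / 5"] by simp
  then show "area_unit base_obtuse = prototile_unit"
    using pos golden_gt_1
    by (simp add: base_obtuse_def prototile_unit_def wedge_def abs_mult) (simp add: golden_eq_cos)
qed

lemma area_unit_prototile:
  assumes "S \<in> prototiles" shows "area_unit S = prototile_unit"
proof -
  have refl: "\<bar>wedge (plane_reflection x) (plane_reflection y)\<bar> = \<bar>wedge x y\<bar>" for x y
    by (simp add: plane_reflection_def wedge_def algebra_simps abs_minus_commute)
  have rot: "wedge (plane_rotation t x) (plane_rotation t y) = wedge x y" for t x y
  proof -
    have "wedge (plane_rotation t x) (plane_rotation t y) = ((sin t)\<^sup>2 + (cos t)\<^sup>2) * wedge x y"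
      unfolding wedge_def plane_rotation_def vector_2 power2_eq_square by algebra
    then show ?thesis by simp
  qed
  have lin: "plane_rotation t x - plane_rotation t y = plane_rotation t (x - y)"
    "plane_reflection x - plane_reflection y = plane_reflection (x - y)" for t x y
    by (simp_all add: vec_eq_iff forall_2 plane_rotation_def plane_reflection_def algebra_simps)
  obtain k g T where S: "S = map_tile (plane_rotation (real k * (pi / 5)) \<circ> g) T"
    and g: "g \<in> {id, plane_reflection}" and T: "T \<in> {base_acute, base_obtuse}"
    using assms by (auto simp: prototiles_def)
  have "area_unit S = 1 * area_unit T"
    unfolding S
    by (rule area_unit_linear[where g = "plane_rotation (real k * (pi / 5)) \<circ> g"])
      (use g in \<open>auto simp: lin rot refl\<close>)
  then show ?thesis using T area_unit_base by auto
qed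

lemma finite_prototiles: "finite prototiles"
proof -
  have "prototiles \<subseteq> (\<lambda>(k, g, T). map_tile (plane_rotation (real k * (pi / 5)) \<circ> g) T) `
      ({..<10} \<times> {id, plane_reflection} \<times> {base_acute, base_obtuse})"
    by (auto simp: prototiles_def image_iff)
  then show ?thesis by (rule finite_subset) simp
qed

lemma closure_interior_region:
  assumes "area_unit T > 0"
  shows "closure (interior (region T)) = region T"
proof -
  have "interior (region T) \<noteq> {}"
    using not_negligible_region[OF assms] negligible_convex_interior[OF convex_region, of T] by simp
  then show ?thesis
    using convex_closure_interior[OF convex_region] closure_closed[OF closed_region] by metis
qed

lemma interior_region_Int:
  assumes "area_unit T' > 0" "z \<in> interior (region T)" "z \<in> region T'"
  shows "interior (region T) \<inter> interior (region T') \<noteq> {}"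
proof
  assume "interior (region T) \<inter> interior (region T') = {}"
  then have "interior (region T) \<inter> closure (interior (region T')) = {}"
    by (simp add: open_Int_closure_eq_empty)
  then show False using assms(2,3) closure_interior_region[OF assms(1)] by auto
qed

section \<open>Discrepancy in a Penrose tiling\<close>

lemma penrose_tilingD:
  assumes "penrose_tiling \<tau>"
  shows "T \<in> \<tau> \<Longrightarrow> \<exists>S\<in>prototiles. \<exists>v. T = translate_tile v S"
    and "(\<Union>T\<in>\<tau>. region T) = UNIV"
    and "T \<in> \<tau> \<Longrightarrow> T' \<in> \<tau> \<Longrightarrow> T \<noteq> T' \<Longrightarrow> interior (region T) \<inter> interior (region T') = {}"
    and "finite \<C> \<Longrightarrow> \<C> \<subseteq> \<tau> \<Longrightarrow>
      \<exists>S\<in>prototiles. \<exists>m v. translate_tile v ` \<C> \<subseteq> (inflated_H ^^ m) {S}"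
  using assms by (simp_all add: penrose_tiling_def)

lemma area_unit_penrose:
  assumes "penrose_tiling \<tau>" "T \<in> \<tau>"
  shows "area_unit T = prototile_unit"
  using penrose_tilingD(1)[OF assms] area_unit_translate area_unit_prototile by auto

lemma penrose_diameter:
  assumes "penrose_tiling \<tau>"
  obtains D where "\<And>T x y. T \<in> \<tau> \<Longrightarrow> x \<in> region T \<Longrightarrow> y \<in> region T \<Longrightarrow> dist x y \<le> D"
proof -
  have "bounded (\<Union>S\<in>prototiles. region S)"
    using finite_prototiles compact_region compact_imp_bounded by (intro bounded_UN) auto
  then obtain b where b: "\<And>S x. S \<in> prototiles \<Longrightarrow> x \<in> region S \<Longrightarrow> norm x \<le> b"
    unfolding bounded_iff by blast
  show thesis
  proof (rule that[of "2 * b"])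
    fix T x y assume T: "T \<in> \<tau>" and xy: "x \<in> region T" "y \<in> region T"
    obtain S v where S: "S \<in> prototiles" "T = translate_tile v S" using penrose_tilingD(1)[OF assms T] by auto
    obtain x' y' where xy': "x' \<in> region S" "y' \<in> region S" "x = v + x'" "y = v + y'"
      using xy unfolding S(2) region_translate by blast
    have "dist x y = norm (x' - y')" by (simp add: xy'(3,4) dist_norm)
    also have "\<dots> \<le> norm x' + norm y'" by (rule norm_triangle_ineq4)
    finally show "dist x y \<le> 2 * b" using b[OF S(1) xy'(1)] b[OF S(1) xy'(2)] by linarith
  qed
qed

lemma penrose_covers:
  assumes "penrose_tiling \<tau>" obtains T where "T \<in> \<tau>" "x \<in> region T"
  using penrose_tilingD(2)[OF assms] by blast

lemma penrose_negligible_Int: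
  assumes "penrose_tiling \<tau>" "T \<in> \<tau>" "T' \<in> \<tau>" "T \<noteq> T'"
  shows "negligible (region T \<inter> region T')"
proof (rule negligible_subset)
  have "interior (region T) \<inter> interior (region T') = {}"
    using penrose_tilingD(3)[OF assms] .
  then show "region T \<inter> region T' \<subseteq> frontier (region T) \<union> frontier (region T')"
    using closed_region by (auto simp: frontier_def)
  show "negligible (frontier (region T) \<union> frontier (region T'))"
    using negligible_convex_frontier[OF convex_region] by (simp add: negligible_Un)
qed

lemma penrose_measure_Union:
  assumes "penrose_tiling \<tau>" "finite F" "F \<subseteq> \<tau>"
  shows "measure lebesgue (\<Union>T\<in>F. region T) = prototile_unit * (\<Sum>T\<in>F. relative_area T)"
proof -
  have "measure lebesgue (\<Union>T\<in>F. region T) = (\<Sum>T\<in>F. measure lebesgue (region T))"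
  proof (rule measure_negligible_finite_Union_image[OF assms(2) lmeasurable_region])
    show "pairwise (\<lambda>x y. negligible (region x \<inter> region y)) F"
      using penrose_negligible_Int[OF assms(1)] assms(3) by (auto simp: pairwise_def)
  qed
  also have "\<dots> = (\<Sum>T\<in>F. prototile_unit * relative_area T)"
    using area_unit_penrose[OF assms(1)] assms(3) by (intro sum.cong) (auto simp: measure_region)
  finally show ?thesis by (simp add: sum_distrib_left)
qed

text \<open>
  Sets of bounded diameter that meet \<open>B\<close> lie in one ball, which has room for only finitely many
  almost disjoint sets of measure at least \<open>c\<close>.
\<close>
lemma locally_finite_packing:
  fixes f :: "'i \<Rightarrow> 'a::euclidean_space set"
  assumes meas: "\<And>i. i \<in> I \<Longrightarrow> f i \<in> lmeasurable" "\<And>i. i \<in> I \<Longrightarrow> c \<le> measure lebesgue (f i)" "c > 0"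
    and disj: "\<And>i j. i \<in> I \<Longrightarrow> j \<in> I \<Longrightarrow> i \<noteq> j \<Longrightarrow> negligible (f i \<inter> f j)"
    and diam: "\<And>i x y. i \<in> I \<Longrightarrow> x \<in> f i \<Longrightarrow> y \<in> f i \<Longrightarrow> dist x y \<le> D"
    and B: "bounded B"
  shows "finite {i \<in> I. f i \<inter> B \<noteq> {}}"
proof -
  obtain b where b: "\<And>x. x \<in> B \<Longrightarrow> norm x \<le> b" using B unfolding bounded_iff by auto
  let ?W = "cball (0::'a) (b + D)"
  have in_W: "f i \<subseteq> ?W" if i: "i \<in> I" "f i \<inter> B \<noteq> {}" for i
  proof
    fix x assume x: "x \<in> f i"
    obtain y where y: "y \<in> f i" "y \<in> B" using i(2) by blast
    have "norm x \<le> norm y + dist x y" by (metis dist_norm norm_triangle_sub)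
    then show "x \<in> ?W" using b[OF y(2)] diam[OF i(1) x y(1)] by simp
  qed
  show ?thesis
  proof (rule conjunct1[OF finite_if_finite_subsets_card_bdd])
    fix G assume G: "G \<subseteq> {i \<in> I. f i \<inter> B \<noteq> {}}" "finite G"
    then have GI: "i \<in> I" if "i \<in> G" for i using that by blast
    have "card G * c \<le> (\<Sum>i\<in>G. measure lebesgue (f i))"
      by (rule sum_bounded_below) (rule meas(2)[OF GI])
    also have "\<dots> = measure lebesgue (\<Union>i\<in>G. f i)"
    proof (rule measure_negligible_finite_Union_image [symmetric])
      show "pairwise (\<lambda>x y. negligible (f x \<inter> f y)) G"
        using disj GI by (simp add: pairwise_def)
    qed (use G(2) meas(1)[OF GI] in auto)
    also have "\<dots> \<le> measure lebesgue ?W"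
    proof (rule measure_mono_fmeasurable)
      show "(\<Union>i\<in>G. f i) \<subseteq> ?W" using in_W G(1) by blast
      show "(\<Union>i\<in>G. f i) \<in> sets lebesgue"
        using G(2) meas(1)[OF GI] by (intro sets.finite_UN) auto
    qed simp
    finally have "real (card G) \<le> measure lebesgue ?W / c"
      using meas(3) by (simp add: pos_le_divide_eq)
    then show "card G \<le> nat \<lfloor>measure lebesgue ?W / c\<rfloor>"
      by (rule le_nat_floor)
  qed
qed

lemma penrose_locally_finite:
  assumes "penrose_tiling \<tau>" "bounded B"
  shows "finite {T \<in> \<tau>. region T \<inter> B \<noteq> {}}"
proof (rule penrose_diameter[OF assms(1)])
  fix D assume D: "\<And>T x y. T \<in> \<tau> \<Longrightarrow> x \<in> region T \<Longrightarrow> y \<in> region T \<Longrightarrow> dist x y \<le> D"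
  have area: "prototile_unit \<le> measure lebesgue (region T)" if "T \<in> \<tau>" for T
    using relative_area_ge_1[of T] prototile_unit_pos area_unit_penrose[OF assms(1) that]
    by (simp add: measure_region)
  show ?thesis
    by (rule locally_finite_packing[OF lmeasurable_region area prototile_unit_pos
        penrose_negligible_Int[OF assms(1)] D assms(2)])
qed

text \<open>
  The translation in the definition of a Penrose tiling is undone on the supertile.
\<close>
lemma penrose_patch:
  assumes "penrose_tiling \<tau>" "finite \<C>" "\<C> \<subseteq> \<tau>"
  obtains m S where "area_unit S > 0" "\<C> \<subseteq> descendants m S"
proof -
  obtain S m v where S: "S \<in> prototiles" "translate_tile v ` \<C> \<subseteq> (inflated_H ^^ m) {S}"
    using penrose_tilingD(4)[OF assms] by auto
  let ?S = "map_tile (\<lambda>x. golden ^ m *\<^sub>R x) S"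
  have undo: "translate_tile (- v) (translate_tile v T) = T" for T
    by (simp add: translate_tile_def tile.map_comp o_def tile.map_ident)
  have "\<C> = translate_tile (- v) ` translate_tile v ` \<C>" by (simp add: image_image undo)
  also have "\<dots> \<subseteq> translate_tile (- v) ` descendants m ?S"
    using S(2) unfolding inflated_H_power by (rule image_mono)
  also have "\<dots> = descendants m (translate_tile (- v) ?S)"
    unfolding translate_tile_def by (rule affine_descendants [symmetric]) simp
  finally have sub: "\<C> \<subseteq> descendants m (translate_tile (- v) ?S)" .
  have "wedge (t *\<^sub>R x) (t *\<^sub>R y) = t\<^sup>2 * wedge x y" for t x y
    by (simp add: wedge_def power2_eq_square algebra_simps)
  then have "area_unit ?S = (golden ^ m)\<^sup>2 * area_unit S"
    by (intro area_unit_linear[where g = "\<lambda>x. golden ^ m *\<^sub>R x"])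
      (simp_all add: scaleR_diff_right abs_mult)
  then have "area_unit (translate_tile (- v) ?S) > 0"
    using prototile_unit_pos golden_gt_1 area_unit_prototile[OF S(1)] by (simp add: area_unit_translate)
  then show thesis using sub by (rule that)
qed

definition neighbours :: "(real^2) tile set \<Rightarrow> (real^2) tile set \<Rightarrow> (real^2) tile set" where
  "neighbours \<tau> F = {T' \<in> \<tau> - F. \<exists>T\<in>F. touches T T'}"

lemma finite_neighbours:
  assumes "penrose_tiling \<tau>" "finite F" shows "finite (neighbours \<tau> F)"
proof (rule finite_subset)
  show "neighbours \<tau> F \<subseteq> {T' \<in> \<tau>. region T' \<inter> (\<Union>T\<in>F. region T) \<noteq> {}}"
    by (auto simp: neighbours_def touches_def)
  show "finite {T' \<in> \<tau>. region T' \<inter> (\<Union>T\<in>F. region T) \<noteq> {}}"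
    using assms(2) compact_region compact_imp_bounded
    by (intro penrose_locally_finite[OF assms(1)] bounded_UN) auto
qed

text \<open>
  The supertile that contains a patch need not agree with the tiling outside of the patch. But all
  tiles of \<open>\<tau>\<close> around a point of \<open>F\<close> belong to the patch and fill a neighbourhood of that point,
  so a tile of the supertile that touches \<open>F\<close> there overlaps one of them and hence is equal to it.
\<close>
lemma touching_tile_in_patch:
  assumes pen: "penrose_tiling \<tau>" and F: "finite F" "F \<subseteq> \<tau>"
    and patch: "area_unit S > 0" "F \<union> neighbours \<tau> F \<subseteq> descendants m S"
    and T: "T \<in> descendants m S" "T' \<in> F" "touches T' T"
  shows "T \<in> F \<union> neighbours \<tau> F"
proof -
  obtain x where x: "x \<in> region T" "x \<in> region T'" using T(3) by (auto simp: touches_def)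
  let ?K = "{R \<in> \<tau>. region R \<inter> ball x 1 \<noteq> {}}"
  let ?W = "\<Union>R\<in>{R \<in> ?K. x \<notin> region R}. region R"
  have "finite ?K" by (rule penrose_locally_finite[OF pen]) simp
  then have "finite {R \<in> ?K. x \<notin> region R}" by (rule finite_subset[rotated]) blast
  then have "closed ?W" using closed_region by (intro closed_UN) auto
  define U where "U = ball x 1 - ?W"
  have "open U" unfolding U_def using \<open>closed ?W\<close> by (intro open_Diff) auto
  moreover have "x \<in> U" by (auto simp: U_def)
  moreover have "x \<in> closure (interior (region T))"
    using x(1) closure_interior_region[OF area_unit_descendants_pos[OF patch(1) T(1)]] by simp
  ultimately have "U \<inter> interior (region T) \<noteq> {}"
    using open_Int_closure_eq_empty[of U "interior (region T)"] by auto
  then obtain z where z: "z \<in> interior (region T)" "z \<in> U" by auto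
  obtain R where R: "R \<in> \<tau>" "z \<in> region R" by (rule penrose_covers[OF pen])
  have "z \<in> region R \<inter> ball x 1" "z \<notin> ?W" using R(2) z(2) by (auto simp: U_def)
  then have "x \<in> region R" using R(1) by blast
  then have R_near: "R \<in> F \<union> neighbours \<tau> F"
    using R(1) x(2) T(2) by (auto simp: neighbours_def touches_def)
  have "T = R"
  proof (rule ccontr)
    assume "T \<noteq> R"
    have "R \<in> descendants m S" using R_near patch(2) by blast
    then have neg: "negligible (region T \<inter> region R)" and pos: "area_unit R > 0"
      using negligible_Int_descendants[OF patch(1) T(1) _ \<open>T \<noteq> R\<close>] area_unit_descendants_pos[OF patch(1)]
      by blast+
    have "negligible (interior (region T) \<inter> interior (region R))"
      by (rule negligible_subset[OF neg]) (use interior_subset in blast)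
    moreover have "open (interior (region T) \<inter> interior (region R))" by (intro open_Int open_interior)
    ultimately show False
      using interior_region_Int[OF pos z(1) R(2)] open_not_negligible by blast
  qed
  then show ?thesis using R_near by simp
qed

text \<open>
  The hierarchy is used inside a finite patch: the one formed by \<open>F\<close> and its neighbours lies
  in some supertile, where the rim of \<open>F\<close> consists of neighbours in \<open>\<tau>\<close>.
\<close>
theorem penrose_discrepancy:
  assumes pen: "penrose_tiling \<tau>" and F: "finite F" "F \<subseteq> \<tau>"
  shows "\<bar>\<Sum>T\<in>F. excess T\<bar> \<le> 2 * golden * excess_unit * card (neighbours \<tau> F)"
proof (cases "F = {}")
  case True
  then show ?thesis using golden_gt_1 excess_unit_pos by simp
next
  case False
  have "bounded (\<Union>T\<in>F. region T)"
    using F(1) compact_region compact_imp_bounded by (intro bounded_UN) auto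
  then have "(\<Union>T\<in>F. region T) \<noteq> UNIV" using not_bounded_UNIV by metis
  then obtain x where x: "x \<notin> (\<Union>T\<in>F. region T)" by blast
  \<comment> \<open>One more tile in the patch guarantees that \<open>F\<close> is not the whole supertile.\<close>
  obtain T0 where T0: "T0 \<in> \<tau>" "x \<in> region T0" by (rule penrose_covers[OF pen])
  have T0': "T0 \<notin> F" using x T0(2) by blast
  obtain m S where S: "area_unit S > 0" "insert T0 (F \<union> neighbours \<tau> F) \<subseteq> descendants m S"
  proof (rule penrose_patch[OF pen])
    show "finite (insert T0 (F \<union> neighbours \<tau> F))" using F finite_neighbours[OF pen] by simp
    show "insert T0 (F \<union> neighbours \<tau> F) \<subseteq> \<tau>" using F(2) T0 by (auto simp: neighbours_def)
  qed
  let ?X = "descendants m S"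
  have XF: "?X \<inter> F = F" using S(2) by blast
  have rim: "rim F ?X \<subseteq> neighbours \<tau> F"
  proof
    fix T assume "T \<in> rim F ?X"
    then obtain T' where T: "T \<in> ?X" "T \<notin> F" "T' \<in> F" "touches T' T" by (auto simp: rim_def)
    have "T \<in> F \<union> neighbours \<tau> F"
      by (rule touching_tile_in_patch[OF pen F S(1) _ T(1,3,4)]) (use S(2) in blast)
    then show "T \<in> neighbours \<tau> F" using T(2) by blast
  qed
  have pos: "2 * golden * excess_unit > 0" using golden_gt_1 excess_unit_pos by simp
  have "\<bar>\<Sum>T\<in>F. excess T\<bar> \<le> 2 * golden * excess_unit * card (rim F ?X) - 2 * golden * excess_unit / golden ^ (2 * m)"
    using excess_mixed_descendants[OF S(1), of m F] XF False S(2) T0' by auto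
  also have "\<dots> \<le> 2 * golden * excess_unit * card (rim F ?X)"
    using pos golden_gt_1 by simp
  also have "\<dots> \<le> 2 * golden * excess_unit * card (neighbours \<tau> F)"
    using pos rim finite_neighbours[OF pen F(1)] by (intro mult_left_mono) (auto intro: card_mono)
  finally show ?thesis .
qed

text \<open>
  Adding the neighbours of \<open>F\<close> compensates its discrepancy in either direction, since every
  neighbour counts as \<open>1\<close> and has area at least \<open>1\<close> in the unit used, while
  \<open>2 * golden * excess_unit \<le> tile_density \<le> 1\<close>.
\<close>
lemma penrose_counting:
  assumes pen: "penrose_tiling \<tau>" and F: "finite F" "F \<subseteq> \<tau>"
  defines "G \<equiv> F \<union> neighbours \<tau> F"
  shows "real (card F) \<le> tile_density * (\<Sum>T\<in>G. relative_area T)"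
    and "tile_density * (\<Sum>T\<in>F. relative_area T) \<le> real (card G)"
proof -
  let ?N = "neighbours \<tau> F"
  have N: "finite ?N" "F \<inter> ?N = {}" using finite_neighbours[OF pen F(1)] by (auto simp: neighbours_def)
  have "(\<Sum>T\<in>F. excess T) = card F - tile_density * (\<Sum>T\<in>F. relative_area T)"
    by (simp add: excess_tile_density sum_subtractf sum_distrib_left)
  then have disc: "\<bar>card F - tile_density * (\<Sum>T\<in>F. relative_area T)\<bar> \<le> 2 * golden * excess_unit * card ?N"
    using penrose_discrepancy[OF pen F] by simp
  have C: "2 * golden * excess_unit * card ?N \<le> tile_density * card ?N"
    using tile_density_ge by (rule mult_right_mono) simp
  have "real (card ?N) \<le> (\<Sum>T\<in>?N. relative_area T)"
    using sum_bounded_below[of ?N 1 relative_area, OF relative_area_ge_1] by simp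
  then have "tile_density * card ?N \<le> tile_density * (\<Sum>T\<in>?N. relative_area T)"
    using tile_density_pos by (intro mult_left_mono) auto
  moreover have "(\<Sum>T\<in>G. relative_area T) = (\<Sum>T\<in>F. relative_area T) + (\<Sum>T\<in>?N. relative_area T)"
    unfolding G_def using F N by (intro sum.union_disjoint)
  ultimately show "real (card F) \<le> tile_density * (\<Sum>T\<in>G. relative_area T)"
    using disc C by (simp add: distrib_left)
  have "tile_density \<le> 1" using golden_gt_1 excess_unit_pos by (simp add: tile_density_def)
  then have "tile_density * card ?N \<le> 1 * real (card ?N)" by (rule mult_right_mono) simp
  moreover have "card G = card F + card ?N" unfolding G_def using F N by (intro card_Un_disjoint)
  ultimately show "tile_density * (\<Sum>T\<in>F. relative_area T) \<le> real (card G)" using disc C by simp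
qed

section \<open>Matching tiles with lattice points\<close>

definition lattice_cell :: "real \<Rightarrow> real^'n \<Rightarrow> (real^'n) set" where
  "lattice_cell \<beta> z = cbox (\<beta> *\<^sub>R z) (\<beta> *\<^sub>R (z + 1))"

lemma mem_lattice_cell:
  "x \<in> lattice_cell \<beta> z \<longleftrightarrow> (\<forall>i. \<beta> * z $ i \<le> x $ i \<and> x $ i \<le> \<beta> * (z $ i + 1))"
  by (simp add: lattice_cell_def mem_box_cart)

lemma lmeasurable_lattice_cell: "lattice_cell \<beta> z \<in> lmeasurable"
  by (simp add: lattice_cell_def)

lemma measure_lattice_cell:
  fixes z :: "real^2"
  assumes "\<beta> > 0" shows "measure lebesgue (lattice_cell \<beta> z) = \<beta>\<^sup>2"
proof -
  have "lattice_cell \<beta> z \<noteq> {}"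
    using assms by (simp add: lattice_cell_def interval_ne_empty_cart)
  then have "measure lborel (lattice_cell \<beta> z) = (\<Prod>i\<in>UNIV. (\<beta> *\<^sub>R (z + 1)) $ i - (\<beta> *\<^sub>R z) $ i)"
    unfolding lattice_cell_def by (rule content_cbox_cart)
  also have "\<dots> = \<beta>\<^sup>2" by (simp add: distrib_left)
  finally show ?thesis by (simp add: lattice_cell_def)
qed

lemma lattice_cells_cover:
  assumes "\<beta> > 0" obtains z where "z \<in> int_lattice" "x \<in> lattice_cell \<beta> z"
proof
  define z where "z = (\<chi> i. real_of_int \<lfloor>x $ i / \<beta>\<rfloor>)"
  show "z \<in> int_lattice" by (simp add: int_lattice_def z_def)
  show "x \<in> lattice_cell \<beta> z"
    unfolding mem_lattice_cell
  proof (intro allI conjI)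
    fix i
    have "z $ i \<le> x $ i / \<beta>" "x $ i / \<beta> \<le> z $ i + 1" unfolding z_def vec_lambda_beta by linarith+
    then show "\<beta> * z $ i \<le> x $ i" "x $ i \<le> \<beta> * (z $ i + 1)"
      using assms by (simp_all only: pos_le_divide_eq pos_divide_le_eq mult.commute)
  qed
qed

lemma negligible_Int_lattice_cells:
  assumes "\<beta> > 0" "z \<in> int_lattice" "z' \<in> int_lattice" "z \<noteq> z'"
  shows "negligible (lattice_cell \<beta> z \<inter> lattice_cell \<beta> z')"
proof -
  have separated: "negligible (lattice_cell \<beta> z \<inter> lattice_cell \<beta> z')"
    if z: "z \<in> int_lattice" "z' \<in> int_lattice" "z $ i < z' $ i" for z z' i
  proof (rule negligible_subset)
    obtain m n where mn: "z $ i = of_int m" "z' $ i = of_int n"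
      using z(1,2) unfolding int_lattice_def by (metis Ints_cases mem_Collect_eq)
    then have "z $ i + 1 \<le> z' $ i" using z(3) by simp
    then have "\<beta> * (z $ i + 1) \<le> \<beta> * z' $ i" using assms(1) by (intro mult_left_mono) auto
    then show "lattice_cell \<beta> z \<inter> lattice_cell \<beta> z' \<subseteq> {x. x $ i = \<beta> * z' $ i}"
      unfolding mem_lattice_cell subset_iff Int_iff mem_Collect_eq by (meson order_antisym order_trans)
    show "negligible {x::real^2. x $ i = \<beta> * z' $ i}" 
      by (simp add: cart_eq_inner_axis negligible_standard_hyperplane)
  qed
  obtain i where "z $ i < z' $ i \<or> z' $ i < z $ i"
    using assms(4) by (metis vec_eq_iff linorder_less_linear)
  then show ?thesis using separated assms(2,3) by (metis Int_commute)
qed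

lemma lattice_cell_diameter:
  fixes x y :: "real^2"
  assumes "\<beta> > 0" "x \<in> lattice_cell \<beta> z" "y \<in> lattice_cell \<beta> z"
  shows "dist x y \<le> 2 * \<beta>"
proof -
  have "\<bar>(x - y) $ i\<bar> \<le> \<beta>" for i
  proof -
    have "\<beta> * z $ i \<le> x $ i" "x $ i \<le> \<beta> * z $ i + \<beta>" "\<beta> * z $ i \<le> y $ i" "y $ i \<le> \<beta> * z $ i + \<beta>"
      using assms(2,3) by (simp_all add: mem_lattice_cell distrib_left)
    then show ?thesis by (simp add: abs_le_iff)
  qed
  then have "(\<Sum>i\<in>UNIV. \<bar>(x - y) $ i\<bar>) \<le> of_nat (card (UNIV::2 set)) * \<beta>"
    by (intro sum_bounded_above)
  then show ?thesis using norm_le_l1_cart[of "x - y"] by (simp add: dist_norm)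
qed

lemma lattice_cells_locally_finite:
  assumes "\<beta> > 0" "bounded B"
  shows "finite {z \<in> int_lattice. lattice_cell \<beta> z \<inter> B \<noteq> {}}"
proof (rule locally_finite_packing[OF lmeasurable_lattice_cell _ _ _ _ assms(2)])
  show "\<beta>\<^sup>2 \<le> measure lebesgue (lattice_cell \<beta> z)" for z :: "real^2"
    by (simp add: measure_lattice_cell[OF assms(1)])
  show "\<beta>\<^sup>2 > 0" using assms(1) by simp
qed (use negligible_Int_lattice_cells lattice_cell_diameter assms(1) in blast)+

lemma measure_lattice_cells:
  assumes "\<beta> > 0" "finite J" "J \<subseteq> int_lattice"
  shows "measure lebesgue (\<Union>z\<in>J. lattice_cell \<beta> z) = \<beta>\<^sup>2 * card J"
proof -
  have "measure lebesgue (\<Union>z\<in>J. lattice_cell \<beta> z) = (\<Sum>z\<in>J. measure lebesgue (lattice_cell \<beta> z))"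
  proof (rule measure_negligible_finite_Union_image[OF assms(2) lmeasurable_lattice_cell])
    show "pairwise (\<lambda>x y. negligible (lattice_cell \<beta> x \<inter> lattice_cell \<beta> y)) J"
      using negligible_Int_lattice_cells[OF assms(1)] assms(3) by (auto simp: pairwise_def)
  qed
  then show ?thesis by (simp add: measure_lattice_cell[OF assms(1)])
qed

text \<open>
  The side of a square whose area is the average area per tile.
\<close>
definition mesh :: real where
  "mesh = sqrt (prototile_unit / tile_density)"

lemma mesh_pos: "mesh > 0"
  using prototile_unit_pos tile_density_pos by (simp add: mesh_def)

lemma mesh_square: "mesh\<^sup>2 * tile_density = prototile_unit"
  using prototile_unit_pos tile_density_pos by (simp add: mesh_def)

text \<open>
  Cells are compared with tiles through one intermediate tile, because a set of tiles is enlarged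
  by its neighbours before it is compared with the cells. The same relation serves both directions.
\<close>
definition close_to :: "(real^2) tile set \<Rightarrow> ((real^2) tile \<times> (real^2)) set" where
  "close_to \<tau> = {(T, z). T \<in> \<tau> \<and> z \<in> int_lattice \<and>
     (\<exists>T'\<in>\<tau>. touches T T' \<and> region T' \<inter> lattice_cell mesh z \<noteq> {})}"

lemma bounded_region: "bounded (region T)"
  by (simp add: compact_region compact_imp_bounded)

lemma finite_close_to:
  assumes pen: "penrose_tiling \<tau>"
  shows "finite (close_to \<tau> `` {T})" and "finite ((close_to \<tau>)\<inverse> `` {z})"
proof -
  have fin: "finite {T' \<in> \<tau>. region T' \<inter> region T \<noteq> {}}" for T
    by (rule penrose_locally_finite[OF pen bounded_region])
  have "close_to \<tau> `` {T} \<subseteq> (\<Union>T'\<in>{T' \<in> \<tau>. region T' \<inter> region T \<noteq> {}}.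
      {z \<in> int_lattice. lattice_cell mesh z \<inter> region T' \<noteq> {}})"
    by (auto simp: close_to_def touches_def)
  moreover have "finite \<dots>"
    using fin lattice_cells_locally_finite[OF mesh_pos bounded_region] by (intro finite_UN_I)
  ultimately show "finite (close_to \<tau> `` {T})" by (rule finite_subset)
  have "bounded (lattice_cell mesh z)" by (simp add: lattice_cell_def)
  then have "finite {T' \<in> \<tau>. region T' \<inter> lattice_cell mesh z \<noteq> {}}"
    by (rule penrose_locally_finite[OF pen])
  then have "finite (\<Union>T'\<in>{T' \<in> \<tau>. region T' \<inter> lattice_cell mesh z \<noteq> {}}.
      {T \<in> \<tau>. region T \<inter> region T' \<noteq> {}})"
    using fin by (rule finite_UN_I)
  moreover have "(close_to \<tau>)\<inverse> `` {z} \<subseteq> (\<Union>T'\<in>{T' \<in> \<tau>. region T' \<inter> lattice_cell mesh z \<noteq> {}}.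
      {T \<in> \<tau>. region T \<inter> region T' \<noteq> {}})"
    by (auto simp: close_to_def touches_def)
  ultimately show "finite ((close_to \<tau>)\<inverse> `` {z})" by (rule rev_finite_subset)
qed

text \<open>
  The number of tiles is at most the area of the tiles and their neighbours, divided by the average
  area per tile, and this area is covered by the cells of the related lattice points.
\<close>
lemma card_tiles_le_card_cells:
  assumes pen: "penrose_tiling \<tau>" and J: "finite J" "J \<subseteq> \<tau>"
  shows "card J \<le> card (close_to \<tau> `` J)"
proof -
  let ?G = "J \<union> neighbours \<tau> J" and ?Z = "close_to \<tau> `` J"
  have G: "finite ?G" "?G \<subseteq> \<tau>" using J finite_neighbours[OF pen] by (auto simp: neighbours_def)
  have "?Z = (\<Union>T\<in>J. close_to \<tau> `` {T})" by blast
  then have Z: "finite ?Z" "?Z \<subseteq> int_lattice"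
    using J(1) finite_close_to(1)[OF pen] by (simp, auto simp: close_to_def)
  have cover: "(\<Union>T\<in>?G. region T) \<subseteq> (\<Union>z\<in>?Z. lattice_cell mesh z)"
  proof
    fix x assume "x \<in> (\<Union>T\<in>?G. region T)"
    then obtain T' where T': "T' \<in> ?G" "x \<in> region T'" by blast
    obtain T where T: "T \<in> J" "touches T T'"
      using T'(1) touches_refl by (auto simp: neighbours_def)
    obtain z where z: "z \<in> int_lattice" "x \<in> lattice_cell mesh z"
      by (rule lattice_cells_cover[OF mesh_pos])
    have "T \<in> \<tau>" "T' \<in> \<tau>" "region T' \<inter> lattice_cell mesh z \<noteq> {}" using T(1) J(2) T' G(2) z(2) by blast+
    then have "(T, z) \<in> close_to \<tau>" using T(2) z(1) by (auto simp: close_to_def)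
    then show "x \<in> (\<Union>z\<in>?Z. lattice_cell mesh z)" using T(1) z(2) by blast
  qed
  have "mesh\<^sup>2 * card J \<le> mesh\<^sup>2 * (tile_density * (\<Sum>T\<in>?G. relative_area T))"
    using penrose_counting(1)[OF pen J] by (intro mult_left_mono) auto
  also have "\<dots> = measure lebesgue (\<Union>T\<in>?G. region T)"
    using penrose_measure_Union[OF pen G] by (simp add: mesh_square flip: mult.assoc)
  also have "\<dots> \<le> measure lebesgue (\<Union>z\<in>?Z. lattice_cell mesh z)"
  proof (rule measure_mono_fmeasurable[OF cover])
    show "(\<Union>T\<in>?G. region T) \<in> sets lebesgue"
      using G(1) lmeasurable_region by (intro sets.finite_UN) auto
    show "(\<Union>z\<in>?Z. lattice_cell mesh z) \<in> lmeasurable"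
      using Z(1) lmeasurable_lattice_cell by (intro fmeasurable.finite_UN)
  qed
  also have "\<dots> = mesh\<^sup>2 * card ?Z" by (rule measure_lattice_cells[OF mesh_pos Z])
  finally show ?thesis using mesh_pos by simp
qed

text \<open>
  The cells are covered by the tiles that they meet, and the area of these tiles, divided by the
  average area per tile, is at most the number of the tiles and their neighbours.
\<close>
lemma card_cells_le_card_tiles:
  assumes pen: "penrose_tiling \<tau>" and J: "finite J" "J \<subseteq> int_lattice"
  shows "card J \<le> card ((close_to \<tau>)\<inverse> `` J)"
proof -
  let ?U = "\<Union>z\<in>J. lattice_cell mesh z"
  define F where "F = {T \<in> \<tau>. region T \<inter> ?U \<noteq> {}}"
  let ?G = "F \<union> neighbours \<tau> F"
  have "bounded ?U" using J(1) by (intro bounded_UN) (auto simp: lattice_cell_def)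
  then have F: "finite F" "F \<subseteq> \<tau>"
    using penrose_locally_finite[OF pen] by (auto simp: F_def)
  have cover: "?U \<subseteq> (\<Union>T\<in>F. region T)"
  proof
    fix x assume x: "x \<in> ?U"
    obtain T where "T \<in> \<tau>" "x \<in> region T" by (rule penrose_covers[OF pen])
    then have "T \<in> F" unfolding F_def using x by blast
    then show "x \<in> (\<Union>T\<in>F. region T)" using \<open>x \<in> region T\<close> by blast
  qed
  have "mesh\<^sup>2 * card J = measure lebesgue ?U" by (rule measure_lattice_cells[OF mesh_pos J, symmetric])
  also have "\<dots> \<le> measure lebesgue (\<Union>T\<in>F. region T)"
  proof (rule measure_mono_fmeasurable[OF cover])
    show "?U \<in> sets lebesgue"
      using J(1) lmeasurable_lattice_cell by (intro sets.finite_UN) auto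
    show "(\<Union>T\<in>F. region T) \<in> lmeasurable"
      using F(1) lmeasurable_region by (intro fmeasurable.finite_UN)
  qed
  also have "\<dots> = mesh\<^sup>2 * (tile_density * (\<Sum>T\<in>F. relative_area T))"
    using penrose_measure_Union[OF pen F] by (simp add: mesh_square flip: mult.assoc)
  also have "\<dots> \<le> mesh\<^sup>2 * card ?G"
    using penrose_counting(2)[OF pen F] by (intro mult_left_mono) auto
  finally have "card J \<le> card ?G" using mesh_pos by simp
  also have "\<dots> \<le> card ((close_to \<tau>)\<inverse> `` J)"
  proof (rule card_mono)
    have "(close_to \<tau>)\<inverse> `` J = (\<Union>z\<in>J. (close_to \<tau>)\<inverse> `` {z})" by blast
    then show "finite ((close_to \<tau>)\<inverse> `` J)"
      using J(1) finite_close_to(2)[OF pen] by simp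
    show "?G \<subseteq> (close_to \<tau>)\<inverse> `` J"
    proof
      fix T assume T: "T \<in> ?G"
      then obtain T' where T': "T' \<in> F" "touches T' T"
        using touches_refl by (auto simp: neighbours_def)
      obtain z where z: "z \<in> J" "region T' \<inter> lattice_cell mesh z \<noteq> {}"
        using T'(1) unfolding F_def by blast
      have "T \<in> \<tau>" "T' \<in> \<tau>" "z \<in> int_lattice" "touches T T'"
        using T F(2) T' z(1) J(2) touches_sym by (auto simp: neighbours_def)
      then have "(T, z) \<in> close_to \<tau>" using z(2) by (auto simp: close_to_def)
      then show "T \<in> (close_to \<tau>)\<inverse> `` J" using z(1) by blast
    qed
  qed
  finally show ?thesis .
qed

theorem penrose_bounded_displacement:
  assumes pen: "penrose_tiling \<tau>"
  obtains h K where "bij_betw h \<tau> int_lattice"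
    "\<And>T x. T \<in> \<tau> \<Longrightarrow> x \<in> region T \<Longrightarrow> norm (mesh *\<^sub>R h T - x) \<le> K"
proof -
  obtain h where h: "bij_betw h \<tau> int_lattice" "\<And>T. T \<in> \<tau> \<Longrightarrow> (T, h T) \<in> close_to \<tau>"
  proof (rule perfect_matching_infinite)
    show "close_to \<tau> \<subseteq> \<tau> \<times> int_lattice" by (auto simp: close_to_def)
  qed (use finite_close_to[OF pen] card_tiles_le_card_cells[OF pen] card_cells_le_card_tiles[OF pen] in simp_all)
  obtain D where D: "\<And>T x y. T \<in> \<tau> \<Longrightarrow> x \<in> region T \<Longrightarrow> y \<in> region T \<Longrightarrow> dist x y \<le> D"
    using penrose_diameter[OF pen] by metis
  show thesis
  proof (rule that[OF h(1), of "D + D + 2 * mesh"])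
    fix T x assume T: "T \<in> \<tau>" "x \<in> region T"
    obtain T' u w where T': "T' \<in> \<tau>" "u \<in> region T" "u \<in> region T'" "w \<in> region T'"
      "w \<in> lattice_cell mesh (h T)"
      using h(2)[OF T(1)] unfolding close_to_def touches_def by blast
    have "mesh *\<^sub>R h T \<in> lattice_cell mesh (h T)"
      using mesh_pos by (simp add: mem_lattice_cell)
    then have "dist w (mesh *\<^sub>R h T) \<le> 2 * mesh"
      using lattice_cell_diameter[OF mesh_pos T'(5)] by blast
    moreover have "dist x u \<le> D" "dist u w \<le> D" using D T T' by blast+
    moreover have "dist x (mesh *\<^sub>R h T) \<le> dist x u + dist u w + dist w (mesh *\<^sub>R h T)"
      by (metis add_right_mono dist_triangle order_trans)
    ultimately show "norm (mesh *\<^sub>R h T - x) \<le> D + D + 2 * mesh"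
      by (simp add: dist_norm norm_minus_commute)
  qed
qed

section \<open>Norms and bilipschitz maps\<close>

lemma is_normD:
  assumes "is_norm N"
  shows "0 \<le> N x" "N x = 0 \<longleftrightarrow> x = 0" "N (c *\<^sub>R x) = \<bar>c\<bar> * N x" "N (x + y) \<le> N x + N y"
  using assms unfolding is_norm_def by blast+

lemma is_norm_minus_commute:
  assumes "is_norm N" shows "N (x - y) = N (y - x)"
  using is_normD(3)[OF assms, of "-1" "x - y"] by simp

lemma is_norm_upper:
  fixes N :: "'a::euclidean_space \<Rightarrow> real"
  assumes "is_norm N" obtains M where "M > 0" "\<And>x. N x \<le> M * norm x"
proof -
  have sum: "N (\<Sum>b\<in>A. f b) \<le> (\<Sum>b\<in>A. N (f b))" if "finite A" for A :: "'a set" and f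
    using that
  proof (induction A)
    case empty
    then show ?case using is_normD(2)[OF assms, of 0] by simp
  next
    case (insert b A)
    then show ?case using is_normD(4)[OF assms, of "f b" "\<Sum>b\<in>A. f b"] by simp
  qed
  let ?M = "(\<Sum>b\<in>Basis. N b) + 1"
  have nonneg: "0 \<le> (\<Sum>b\<in>Basis. N b)" by (intro sum_nonneg is_normD(1)[OF assms])
  have "N x \<le> ?M * norm x" for x
  proof -
    have "N x = N (\<Sum>b\<in>Basis. (x \<bullet> b) *\<^sub>R b)" by (simp add: euclidean_representation)
    also have "\<dots> \<le> (\<Sum>b\<in>Basis. N ((x \<bullet> b) *\<^sub>R b))" by (rule sum) simp
    also have "\<dots> \<le> (\<Sum>b\<in>Basis. norm x * N b)"
      unfolding is_normD(3)[OF assms]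
      by (intro sum_mono mult_right_mono Basis_le_norm is_normD(1)[OF assms])
    also have "\<dots> = norm x * (\<Sum>b\<in>Basis. N b)" by (rule sum_distrib_left [symmetric])
    also have "\<dots> \<le> ?M * norm x" by (simp add: algebra_simps)
    finally show ?thesis .
  qed
  moreover have "?M > 0" using nonneg by linarith
  ultimately show thesis using that by blast
qed

text \<open>
  The minimum of \<open>N\<close> on the compact Euclidean unit sphere is positive.
\<close>
lemma is_norm_lower:
  fixes N :: "'a::euclidean_space \<Rightarrow> real"
  assumes "is_norm N" obtains c where "c > 0" "\<And>x. c * norm x \<le> N x"
proof -
  obtain M where M: "M > 0" "\<And>x. N x \<le> M * norm x" using is_norm_upper[OF assms] by metis
  have lip: "\<bar>N x - N y\<bar> \<le> M * norm (x - y)" for x y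
  proof -
    have "N x \<le> N y + N (x - y)" "N y \<le> N x + N (x - y)"
      using is_normD(4)[OF assms, of y "x - y"] is_normD(4)[OF assms, of x "y - x"]
        is_norm_minus_commute[OF assms, of x y] by simp_all
    then show ?thesis using M(2)[of "x - y"] by linarith
  qed
  have "M-lipschitz_on UNIV N"
    using lip M(1) by (intro lipschitz_onI) (auto simp: dist_norm)
  then have "continuous_on (sphere 0 1) N"
    by (metis lipschitz_on_continuous_on continuous_on_subset subset_UNIV)
  then obtain u where u: "u \<in> sphere 0 1" "\<And>x. x \<in> sphere 0 1 \<Longrightarrow> N u \<le> N x"
    using continuous_attains_inf[of "sphere (0::'a) 1" N] by auto
  have "N u \<noteq> 0" using u(1) is_normD(2)[OF assms, of u] by auto
  then have pos: "N u > 0" using is_normD(1)[OF assms, of u] by linarith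
  have "N u * norm x \<le> N x" for x
  proof (cases "x = 0")
    case True
    then show ?thesis using is_normD(2)[OF assms, of 0] by simp
  next
    case False
    have "N x = norm x * N ((1 / norm x) *\<^sub>R x)"
      using False by (simp add: is_normD(3)[OF assms])
    moreover have "N u \<le> N ((1 / norm x) *\<^sub>R x)" using False by (intro u(2)) simp
    then have "norm x * N u \<le> norm x * N ((1 / norm x) *\<^sub>R x)" by (intro mult_left_mono) auto
    ultimately show ?thesis by (simp only: mult.commute)
  qed
  then show thesis using pos that by blast
qed

lemma separated_net_norm_ge:
  assumes N: "is_norm N" and Y: "separated_net Y"
  obtains r where "r > 0" "\<And>y y'. y \<in> Y \<Longrightarrow> y' \<in> Y \<Longrightarrow> y \<noteq> y' \<Longrightarrow> r \<le> N (y - y')"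
proof -
  obtain r where r: "r > 0" "\<And>x y y'. y \<in> ball x r \<inter> Y \<Longrightarrow> y' \<in> ball x r \<inter> Y \<Longrightarrow> y = y'"
    using Y unfolding separated_net_def by blast
  obtain c where c: "c > 0" "\<And>x. c * norm x \<le> N x" using is_norm_lower[OF N] by metis
  show thesis
  proof (rule that[of "c * r"])
    fix y y' assume y: "y \<in> Y" "y' \<in> Y" "y \<noteq> y'"
    have "y' \<notin> ball y r" using r(2)[of y y y'] r(1) y by auto
    then have "r \<le> norm (y - y')" by (simp add: dist_norm)
    then have "c * r \<le> c * norm (y - y')" using c(1) by (intro mult_left_mono) auto
    then show "c * r \<le> N (y - y')" using c(2)[of "y - y'"] by linarith
  qed (use c r in simp)
qed

lemma int_lattice_norm_ge:
  assumes N: "is_norm N"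
  obtains r where "r > 0" "\<And>z z'. z \<in> int_lattice \<Longrightarrow> z' \<in> int_lattice \<Longrightarrow> z \<noteq> z' \<Longrightarrow> r \<le> N (z - z')"
proof -
  obtain c where c: "c > 0" "\<And>x. c * norm x \<le> N x" using is_norm_lower[OF N] by metis
  have "c \<le> N (z - z')" if z: "z \<in> int_lattice" "z' \<in> int_lattice" "z \<noteq> z'" for z z'
  proof -
    obtain i where "(z - z') $ i \<noteq> 0" using z(3) by (metis vec_eq_iff right_minus_eq zero_index)
    moreover have "(z - z') $ i \<in> \<int>" using z(1,2) by (simp add: int_lattice_def)
    ultimately have "1 \<le> \<bar>(z - z') $ i\<bar>" by (metis Ints_nonzero_abs_ge1)
    then have "1 \<le> norm (z - z')" using component_le_norm_cart[of "z - z'" i] by linarith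
    then have "c * 1 \<le> c * norm (z - z')" using c(1) by (intro mult_left_mono) auto
    then show ?thesis using c(2)[of "z - z'"] by linarith
  qed
  with c(1) show thesis by (rule that)
qed

text \<open>
  Moving both points by at most \<open>s\<close> is a bounded relative change of their distance when the points
  are at least \<open>r\<close> apart.
\<close>
lemma bounded_displacement_expansion:
  assumes N: "is_norm N" and s: "N (a - x) \<le> s" "N (b - y) \<le> s" and r: "0 < r" "r \<le> N (x - y)"
  shows "N (a - b) \<le> (1 + 2 * s / r) * N (x - y)"
proof -
  have "a - b = (x - y) + ((a - x) + (y - b))" by simp
  then have "N (a - b) \<le> N (x - y) + N ((a - x) + (y - b))" using is_normD(4)[OF N] by metis
  also have "N ((a - x) + (y - b)) \<le> N (a - x) + N (y - b)" by (rule is_normD(4)[OF N])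
  also have "N (y - b) = N (b - y)" by (rule is_norm_minus_commute[OF N])
  finally have "N (a - b) \<le> N (x - y) + 2 * s" using s by linarith
  moreover have "2 * s * 1 \<le> 2 * s * (N (x - y) / r)"
    using r is_normD(1)[OF N, of "a - x"] s(1) by (intro mult_left_mono) auto
  ultimately show ?thesis by (simp add: algebra_simps)
qed

theorem corollary1p5:
  fixes N :: "real^2 \<Rightarrow> real" and Y :: "(real^2) set" and \<tau> :: "(real^2) tile set"
  assumes "is_norm N"
    and "separated_net Y"
    and "penrose_tiling \<tau>"
    and "created_from Y \<tau>"
  shows "(\<exists>\<beta>>0. \<exists>\<Phi>. bij_betw \<Phi> Y ((\<lambda>z. \<beta> *\<^sub>R z) ` int_lattice) \<and>
            bdd_above ((\<lambda>y. N (\<Phi> y - y)) ` Y)) \<and>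
         (\<exists>\<Psi> C. bij_betw \<Psi> Y int_lattice \<and> C \<ge> 1 \<and>
            (\<forall>y\<in>Y. \<forall>y'\<in>Y. (1 / C) * N (y - y') \<le> N (\<Psi> y - \<Psi> y') \<and>
                            N (\<Psi> y - \<Psi> y') \<le> C * N (y - y')))"
proof -
  note N = assms(1)
  obtain p where p: "bij_betw p \<tau> Y" "\<And>T. T \<in> \<tau> \<Longrightarrow> p T \<in> region T"
    using assms(4) unfolding created_from_def by auto
  obtain h K where h: "bij_betw h \<tau> int_lattice"
    "\<And>T x. T \<in> \<tau> \<Longrightarrow> x \<in> region T \<Longrightarrow> norm (mesh *\<^sub>R h T - x) \<le> K"
    using penrose_bounded_displacement[OF assms(3)] by metis
  obtain M where M: "M > 0" "\<And>x. N x \<le> M * norm x" using is_norm_upper[OF N] by metis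
  define q where "q = inv_into \<tau> p"
  define \<Psi> where "\<Psi> = h \<circ> q"
  define \<Phi> where "\<Phi> = (\<lambda>y. mesh *\<^sub>R \<Psi> y)"
  define s where "s = M * K"
  have q: "bij_betw q Y \<tau>" unfolding q_def using p(1) by (rule bij_betw_inv_into)
  have pq: "q y \<in> \<tau>" "p (q y) = y" if "y \<in> Y" for y
    using that p(1) bij_betwE[OF q] by (auto simp: q_def bij_betw_inv_into_right)
  have \<Psi>: "bij_betw \<Psi> Y int_lattice" unfolding \<Psi>_def using q h(1) by (rule bij_betw_trans)
  have scale: "bij_betw (\<lambda>z. mesh *\<^sub>R z) int_lattice ((\<lambda>z. mesh *\<^sub>R z) ` int_lattice)"
    using mesh_pos by (simp add: bij_betw_def inj_on_def)
  have \<Phi>: "bij_betw \<Phi> Y ((\<lambda>z. mesh *\<^sub>R z) ` int_lattice)"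
    using bij_betw_trans[OF \<Psi> scale] by (simp add: \<Phi>_def o_def)
  have s: "N (\<Phi> y - y) \<le> s" if "y \<in> Y" for y
  proof -
    have "norm (mesh *\<^sub>R h (q y) - y) \<le> K"
      using h(2)[OF pq(1)[OF that] p(2)[OF pq(1)[OF that]]] pq(2)[OF that] by simp
    then have "M * norm (mesh *\<^sub>R h (q y) - y) \<le> M * K" using M(1) by (intro mult_left_mono) auto
    then show ?thesis using M(2)[of "\<Phi> y - y"] by (simp add: s_def \<Phi>_def \<Psi>_def)
  qed
  have part1: "\<exists>\<beta>>0. \<exists>\<Phi>. bij_betw \<Phi> Y ((\<lambda>z. \<beta> *\<^sub>R z) ` int_lattice) \<and>
      bdd_above ((\<lambda>y. N (\<Phi> y - y)) ` Y)"
  proof (intro exI conjI)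
    show "bdd_above ((\<lambda>y. N (\<Phi> y - y)) ` Y)" using s by (intro bdd_aboveI2)
  qed (rule mesh_pos \<Phi>)+
  obtain r1 where r1: "r1 > 0" "\<And>y y'. y \<in> Y \<Longrightarrow> y' \<in> Y \<Longrightarrow> y \<noteq> y' \<Longrightarrow> r1 \<le> N (y - y')"
    using separated_net_norm_ge[OF N assms(2)] by metis
  obtain r2 where r2: "r2 > 0" "\<And>z z'. z \<in> int_lattice \<Longrightarrow> z' \<in> int_lattice \<Longrightarrow> z \<noteq> z' \<Longrightarrow> r2 \<le> N (z - z')"
    using int_lattice_norm_ge[OF N] by metis
  \<comment> \<open>The expansion bound is used for \<open>\<Phi>\<close> and for its inverse, so \<open>r\<close> has to separate both \<open>Y\<close> and its image.\<close>
  define r where "r = min r1 (mesh * r2)"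
  have r: "r > 0" using r1 r2 mesh_pos by (simp add: r_def)
  \<comment> \<open>That \<open>s\<close> is nonnegative depends on \<open>Y\<close> being nonempty; \<open>max s 0\<close> avoids this argument.\<close>
  define L where "L = 1 + 2 * max s 0 / r"
  have L: "L \<ge> 1" using r by (simp add: L_def)
  \<comment> \<open>The factor dominates \<open>1\<close>, \<open>mesh\<close> and \<open>1 / mesh\<close>, as needed for passing from \<open>\<Phi>\<close> to \<open>\<Psi> = \<Phi> / mesh\<close>.\<close>
  define C where "C = L * (1 + mesh + 1 / mesh)"
  have C: "C \<ge> 1" "L * mesh \<le> C" "L / mesh \<le> C"
  proof -
    have "L * 1 \<le> C" "L * mesh \<le> C" "L * (1 / mesh) \<le> C"
      unfolding C_def using L mesh_pos by (intro mult_left_mono; simp)+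
    then show "C \<ge> 1" "L * mesh \<le> C" "L / mesh \<le> C" using L by auto
  qed
  have bilip: "(1 / C) * N (y - y') \<le> N (\<Psi> y - \<Psi> y') \<and> N (\<Psi> y - \<Psi> y') \<le> C * N (y - y')"
    if y: "y \<in> Y" "y' \<in> Y" for y y'
  proof (cases "y = y'")
    case True
    then show ?thesis using is_normD(2)[OF N, of 0] by simp
  next
    case False
    have "\<Psi> y \<noteq> \<Psi> y'" "\<Psi> y \<in> int_lattice" "\<Psi> y' \<in> int_lattice"
      using \<Psi> y False by (auto simp: bij_betw_def inj_on_def)
    then have "r2 \<le> N (\<Psi> y - \<Psi> y')" using r2(2) by simp
    then have "mesh * r2 \<le> mesh * N (\<Psi> y - \<Psi> y')" using mesh_pos by (intro mult_left_mono) auto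
    moreover have scaled: "N (\<Phi> y - \<Phi> y') = mesh * N (\<Psi> y - \<Psi> y')"
      using is_normD(3)[OF N, of mesh] mesh_pos by (simp add: \<Phi>_def flip: scaleR_diff_right)
    ultimately have far: "r \<le> N (y - y')" "r \<le> N (\<Phi> y - \<Phi> y')"
      using r1(2)[OF y False] by (simp_all add: r_def)
    have disp: "N (\<Phi> y - y) \<le> max s 0" "N (\<Phi> y' - y') \<le> max s 0"
      "N (y - \<Phi> y) \<le> max s 0" "N (y' - \<Phi> y') \<le> max s 0"
      using s[OF y(1)] s[OF y(2)] is_norm_minus_commute[OF N, of y] is_norm_minus_commute[OF N, of y'] by simp_all
    have up: "mesh * N (\<Psi> y - \<Psi> y') \<le> L * N (y - y')"
      using bounded_displacement_expansion[OF N disp(1,2) r far(1)] by (simp add: scaled L_def)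
    have low: "N (y - y') \<le> L * (mesh * N (\<Psi> y - \<Psi> y'))"
      using bounded_displacement_expansion[OF N disp(3,4) r far(2)] by (simp add: scaled L_def)
    have "N (\<Psi> y - \<Psi> y') \<le> (L / mesh) * N (y - y')"
      using up mesh_pos by (simp add: pos_le_divide_eq mult.commute)
    also have "\<dots> \<le> C * N (y - y')" using C(3) is_normD(1)[OF N] by (rule mult_right_mono)
    finally have 1: "N (\<Psi> y - \<Psi> y') \<le> C * N (y - y')" .
    have "N (y - y') \<le> (L * mesh) * N (\<Psi> y - \<Psi> y')" using low by (simp add: mult.assoc)
    also have "\<dots> \<le> C * N (\<Psi> y - \<Psi> y')" using C(2) is_normD(1)[OF N] by (rule mult_right_mono)
    finally have "(1 / C) * N (y - y') \<le> N (\<Psi> y - \<Psi> y')"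
      using C(1) by (simp add: pos_divide_le_eq mult.commute)
    with 1 show ?thesis by simp
  qed
  show ?thesis using part1 \<Psi> C(1) bilip by blast
qed

end
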